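(* Fix a real number $\theta$ with $0\le\theta<1$. (1) Suppose that for every $\varepsilon>0$ one has $\mathcal F(n)-\frac{\pi}{8}n=O(n^{\theta+\varepsilon})$ for odd $n\in\mathbb N$. Then $\Delta_C(x)=O(x^{\theta+\varepsilon})$ for real $x\ge 1$, for every $\varepsilon>0$. (2) Suppose that for every $\varepsilon>0$ one has $\mathcal F(n)-\frac{3\log 2}{4}n=O(n^{\theta+\varepsilon})$ for even $n\in\mathbb N$. Then $\Delta_H(x)=O(x^{\theta+\varepsilon})$ for real $x\ge 1$, for every $\varepsilon>0$. In all of these bounds the implied constants may depend on $\varepsilon$ and $\theta$ but not on $n$ or $x$.
   Context: The Fibonacci sequence is $F_0=0$, $F_1=1$, $F_{j+2}=F_{j+1}+F_j$ for $j\ge 0$. $\{x\}=x-\lfloor x\rfloor$ is the fractional part and $\log$ is the natural logarithm. $\mathbb N=\{1,2,3,\dots\}$. For $n\in\mathbb N$, $$\mathcal F(n)=\sum_{k=1}^{n}\left\{\frac{F_n}{F_k}\right\}.$$ For real $x\ge 1$ let $N_H(x)=\#\{(a,b)\in\mathbb N^2: ab\le x\}$ and $N_C(x)=\#\{(a,b)\in\mathbb Z^2: a^2+b^2\le x\}$. With $\gamma$ Euler's constant, the error terms $\Delta_H$ and $\Delta_C$ are defined by $$N_H(x)=x\log x+(2\gamma-1)x+\Delta_H(x),\qquad N_C(x)=\pi x+\Delta_C(x).$$ *)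

theory Defs
  imports "HOL-Analysis.Analysis" "HOL-Number_Theory.Fib"
begin

definition fib_frac_sum :: "nat \<Rightarrow> real" where
  "fib_frac_sum n = (\<Sum>k=1..n. frac (real (fib n) / real (fib k)))"

text \<open>Lattice points are counted with \<open>card\<close>; both sets below are finite for every real \<open>x\<close>.\<close>

definition N_H :: "real \<Rightarrow> nat" where
  "N_H x = card {(a::nat, b::nat). a \<ge> 1 \<and> b \<ge> 1 \<and> real (a * b) \<le> x}"

definition N_C :: "real \<Rightarrow> nat" where
  "N_C x = card {(a::int, b::int). real_of_int (a\<^sup>2 + b\<^sup>2) \<le> x}"

definition Delta_H :: "real \<Rightarrow> real" where
  "Delta_H x = real (N_H x) - (x * ln x + (2 * euler_mascheroni - 1) * x)"

definition Delta_C :: "real \<Rightarrow> real" where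
  "Delta_C x = real (N_C x) - pi * x"

end

theory Submission
  imports Defs "HOL-Number_Theory.Number_Theory"
begin

text \<open>
Write \<open>n = q k + r\<close> with \<open>0 \<le> r < k\<close>. Modulo \<open>F\<^sub>k\<close> the number \<open>F\<^sub>n\<close> is plus or minus a Fibonacci number of
index \<open>r\<close> or \<open>k - r\<close>, which is usually tiny compared with \<open>F\<^sub>k\<close>. So the fractional part is close to \<open>0\<close>
for the sign plus and close to \<open>1\<close> for the sign minus (\<open>frac_fib_quotient\<close>). The total deviation is a
convergent series times values of the divisor function, that is, \<open>O(n\<^sup>\<epsilon>)\<close>. Thus the sum of the
fractional parts counts the \<open>k \<le> n\<close> with a negative sign (\<open>fib_frac_sum_wraps_count\<close>), and the sign
depends only on the parities of \<open>n\<close> and \<open>k\<close> and on \<open>q\<close> modulo \<open>4\<close> (\<open>wraps_below_iff\<close>).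

For odd \<open>n\<close> the count is \<open>R(n) - R(n/2)\<close>, where \<open>R(x)\<close> is the sum over \<open>k d \<le> x\<close> of the character
\<open>\<chi>\<^sub>4(d)\<close>. By Jacobi's two-square theorem (\<open>card_circle_points\<close>) the lattice points in the disc number
\<open>1 + 4 R(x)\<close>. Summing the differences at \<open>x, x/2, x/4, \<dots>\<close> recovers \<open>R\<close> with an error that is a
geometric series.

For even \<open>n\<close> the count is \<open>2 D(n/2) - 5 D(n/4) + 2 D(n/8)\<close>, where \<open>D\<close> counts lattice points under the
hyperbola. With \<open>z\<close> standing for halving the argument, this is the polynomial
\<open>2 - 5 z + 2 z\<^sup>2 = (1 - 2 z) (2 - z)\<close> applied to \<open>D\<close> at \<open>n/2\<close>. The factor \<open>2 - z\<close> is inverted by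
descending to \<open>x/2, x/4, \<dots>\<close>. The factor \<open>1 - 2 z\<close> is inverted by ascending to \<open>2 x, 4 x, \<dots>\<close>
(\<open>doubling_recursion_bound\<close>); this needs an exponent below \<open>1\<close> and an error term known to be \<open>o(x)\<close>,
which \<open>dirichlet_divisor_estimate\<close> supplies.
\<close>

section \<open>Residues of Fibonacci numbers\<close>

lemma fib_add_cong:
  assumes "k > 0"
  shows "[int (fib (m + k)) = int (fib (k - 1)) * int (fib m)] (mod int (fib k))"
proof -
  obtain l where k: "k = Suc l" using assms by (cases k) auto
  have "fib (m + k) = fib k * fib (Suc m) + fib l * fib m"
    using fib_add[of m l] by (simp add: k)
  hence "int (fib (m + k)) - int (fib (k - 1)) * int (fib m) = int (fib k) * int (fib (Suc m))"
    by (simp add: k)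
  thus ?thesis by (simp add: cong_iff_dvd_diff)
qed

lemma fib_mult_add_cong:
  assumes "k > 0"
  shows "[int (fib (q * k + r)) = int (fib (k - 1)) ^ q * int (fib r)] (mod int (fib k))"
proof (induction q)
  case (Suc q)
  have "[int (fib ((q * k + r) + k)) = int (fib (k - 1)) * int (fib (q * k + r))] (mod int (fib k))"
    by (rule fib_add_cong[OF assms])
  also have "[int (fib (k - 1)) * int (fib (q * k + r)) =
      int (fib (k - 1)) * (int (fib (k - 1)) ^ q * int (fib r))] (mod int (fib k))"
    by (intro cong_mult cong_refl Suc.IH)
  finally show ?case by (simp add: algebra_simps)
qed auto

lemma fib_pred_square_cong:
  assumes "k > 0"
  shows "[int (fib (k - 1)) ^ 2 = (-1) ^ k] (mod int (fib k))"
proof -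
  obtain l where k: "k = Suc l" using assms by (cases k) auto
  have "int (fib (k - 1)) ^ 2 - (-1) ^ k = int (fib k) * (int (fib k) - int (fib (k - 1)))"
    using fib_Cassini_int[of l] by (simp add: k algebra_simps power2_eq_square)
  thus ?thesis by (simp add: cong_iff_dvd_diff)
qed

text \<open>
A consequence of d'Ocagne's identity. Modulo \<open>fib k\<close> the Fibonacci sequence read backwards from \<open>k\<close>
is, up to alternating signs, \<open>fib (k - 1)\<close> times the sequence itself, since both satisfy the same
recurrence with the same two initial values.
\<close>

lemma fib_pred_mult_cong:
  assumes "r \<le> k" "k > 0"
  shows "[int (fib (k - 1)) * int (fib r) = (-1) ^ (r + 1) * int (fib (k - r))] (mod int (fib k))"
  using assms(1)
proof (induction r rule: fib.induct)
  case 1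
  show ?case by (simp add: cong_iff_dvd_diff)
next
  case 2
  show ?case by (simp add: cong_iff_dvd_diff)
next
  case (3 r)
  obtain j where k: "k = Suc (Suc (r + j))"
    using 3(3) by (metis add_Suc le_Suc_ex)
  have IH1: "[int (fib (k - 1)) * int (fib r) = (-1) ^ (r + 1) * int (fib (Suc (Suc j)))] (mod int (fib k))"
    using 3 by (simp add: k)
  have IH2: "[int (fib (k - 1)) * int (fib (Suc r)) = (-1) ^ (r + 2) * int (fib (Suc j))] (mod int (fib k))"
    using 3 by (simp add: k)
  have "[int (fib (k - 1)) * int (fib r) + int (fib (k - 1)) * int (fib (Suc r)) =
     (-1) ^ (r + 1) * int (fib (Suc (Suc j))) + (-1) ^ (r + 2) * int (fib (Suc j))] (mod int (fib k))"
    by (rule cong_add[OF IH1 IH2])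
  thus ?case by (simp add: k algebra_simps)
qed

text \<open>
With \<open>n = q k + r\<close> and \<open>a = fib (k - 1)\<close> one has \<open>fib n \<equiv> a ^ q * fib r\<close> and \<open>a\<^sup>2 \<equiv> (-1) ^ k\<close>
modulo \<open>fib k\<close>. Hence \<open>fib n\<close> is congruent to plus or minus \<open>fib r\<close> (\<open>q\<close> even) or
\<open>fib (k - r)\<close> (\<open>q\<close> odd). The predicate records when the sign is negative, that is, when
\<open>fib n\<close> lies below a multiple of \<open>fib k\<close>, as a rule only slightly, so that the fractional part of
the quotient is close to \<open>1\<close> instead of \<open>0\<close>.
\<close>

definition wraps_below :: "nat \<Rightarrow> nat \<Rightarrow> bool" where
  "wraps_below n k =
     (let q = n div k in
      if even q then odd (k * (q div 2)) else odd (k * (q div 2) + n mod k + 1))"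

lemma fib_cong_signed:
  fixes k n :: nat
  assumes "k > 0"
  defines "q \<equiv> n div k" and "r \<equiv> n mod k"
  shows "[int (fib n) = (-1) ^ (of_bool (wraps_below n k)) *
           int (if even q then fib r else fib (k - r))] (mod int (fib k))"
proof -
  let ?a = "int (fib (k - 1))" and ?F = "int (fib k)" and ?s = "(-1::int) ^ (k * (q div 2))"
  have sq: "[?a ^ (2 * (q div 2)) = ?s] (mod ?F)"
    using cong_pow[OF fib_pred_square_cong[OF assms(1)], of "q div 2"] by (simp add: power_mult)
  have n: "n = q * k + r" by (simp add: q_def r_def)
  have *: "[int (fib n) = ?a ^ q * int (fib r)] (mod ?F)"
    unfolding n by (rule fib_mult_add_cong[OF assms(1)])
  show ?thesis
  proof (cases "even q")
    case True
    have "[?a ^ q * int (fib r) = ?s * int (fib r)] (mod ?F)"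
      using cong_mult[OF sq cong_refl] True by simp
    moreover have "?s = (-1) ^ (of_bool (wraps_below n k))"
      using True by (auto simp: wraps_below_def q_def[symmetric] Let_def)
    ultimately show ?thesis using * True by (auto intro: cong_trans)
  next
    case False
    hence q: "?a ^ q = ?a ^ (2 * (q div 2)) * ?a"
      by (metis odd_two_times_div_two_succ power_add power_one_right)
    have "r \<le> k" using assms(1) by (simp add: r_def less_imp_le)
    from fib_pred_mult_cong[OF this assms(1)]
    have "[?a ^ q * int (fib r) = ?s * ((-1) ^ (r + 1) * int (fib (k - r)))] (mod ?F)"
      unfolding q mult.assoc by (rule cong_mult[OF sq])
    moreover have sgn: "?s * (-1) ^ (r + 1) = (-1) ^ (of_bool (wraps_below n k))"
      unfolding power_add[symmetric] using False
      by (auto simp: wraps_below_def q_def[symmetric] r_def[symmetric] Let_def minus_one_power_iff)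
    ultimately have "[?a ^ q * int (fib r) =
        (-1) ^ (of_bool (wraps_below n k)) * int (fib (k - r))] (mod ?F)"
      by (simp only: sgn flip: mult.assoc)
    from cong_trans[OF * this] show ?thesis using False by simp
  qed
qed

text \<open>
The case \<open>G = F\<close> is needed because \<open>fib 1 = fib 2\<close>. There the fractional part is \<open>0\<close> and the
bound \<open>1\<close> is trivial for the sign plus, and an equality for the sign minus.
\<close>

lemma frac_signed_residue:
  fixes x F G :: int
  assumes "[x = (-1) ^ (of_bool neg) * G] (mod F)" "0 < G" "G \<le> F"
  shows "\<bar>frac (of_int x / of_int F) - of_bool neg\<bar> \<le> of_int G / (of_int F :: real)"
proof -
  obtain t where t: "x = (-1) ^ (of_bool neg) * G + F * t"
    using assms(1) by (metis cong_iff_lin cong_sym)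
  have F: "real_of_int F > 0" using assms by linarith
  have x: "of_int x / of_int F = of_int t + (-1) ^ (of_bool neg) * (of_int G / of_int F :: real)"
    using F by (simp add: t field_simps)
  have g: "0 < of_int G / (of_int F :: real)" "of_int G / (of_int F :: real) \<le> 1"
    using assms F by (simp_all add: field_simps)
  show ?thesis
  proof (cases neg)
    case True
    have "frac (of_int x / of_int F) = 1 - of_int G / (of_int F :: real)"
      unfolding frac_unique_iff using g True
      by (auto simp: x algebra_simps)
    thus ?thesis using True g by simp
  next
    case False
    \<comment> \<open>The residue itself is then \<open>0\<close>, not \<open>G\<close>.\<close>
    show ?thesis
    proof (cases "G = F")
      case True
      thus ?thesis using False F by (simp add: frac_lt_1 frac_ge_0 less_imp_le)
    next
      case neq: False
      have "frac (of_int x / of_int F) = of_int G / (of_int F :: real)"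
        unfolding frac_unique_iff using g False neq assms F
        by (auto simp: x)
      thus ?thesis using False g by simp
    qed
  qed
qed

lemma fib_mult_le: "fib m * fib (s + 1) \<le> fib (m + s)"
  using fib_add[of s "m - 1"] by (cases m) (auto simp: add_ac mult_ac)

text \<open>
The ratio of the signed residue to \<open>fib k\<close> is \<open>fib r / fib k \<le> 1 / fib (k - r + 1)\<close> or
\<open>fib (k - r) / fib k \<le> 1 / fib (r + 1)\<close>, both by \<open>fib_mult_le\<close>. If \<open>k\<close> divides \<open>n\<close>, the fractional part is \<open>0\<close> irrespective of
the sign, and the first summand on the right is already \<open>1\<close>.
\<close>

lemma frac_fib_quotient:
  assumes "k > 0"
  shows "\<bar>frac (real (fib n) / real (fib k)) - of_bool (wraps_below n k)\<bar>
     \<le> 1 / real (fib (n mod k + 1)) + 1 / real (fib (k - n mod k + 1))"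
proof (cases "n mod k = 0")
  case True
  have "\<bar>frac (real (fib n) / real (fib k)) - of_bool (wraps_below n k)\<bar> \<le> 1"
    using frac_ge_0[of "real (fib n) / real (fib k)"] frac_lt_1[of "real (fib n) / real (fib k)"]
    by (auto simp: of_bool_def)
  also have "\<dots> \<le> 1 / real (fib (n mod k + 1)) + 1 / real (fib (k - n mod k + 1))"
    using True by simp
  finally show ?thesis .
next
  case False
  define r where "r = n mod k"
  have r: "0 < r" "r < k" using False assms by (auto simp: r_def)
  define G where "G = (if even (n div k) then fib r else fib (k - r))"
  have pos: "fib i > 0" if "i > 0" for i using that by (rule fib_neq_0_nat)
  have G: "0 < G" "G \<le> fib k" using r pos by (auto simp: G_def intro: fib_mono)
  have "\<bar>frac (of_int (int (fib n)) / of_int (int (fib k))) - of_bool (wraps_below n k)\<bar>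
           \<le> of_int (int G) / (of_int (int (fib k)) :: real)"
  proof (rule frac_signed_residue)
    show "[int (fib n) = (-1) ^ (of_bool (wraps_below n k)) * int G] (mod int (fib k))"
      using fib_cong_signed[OF assms, of n] unfolding G_def r_def .
  qed (use G in simp_all)
  hence "\<bar>frac (real (fib n) / real (fib k)) - of_bool (wraps_below n k)\<bar> \<le> real G / real (fib k)"
    by simp
  also have "\<dots> \<le> 1 / real (fib (r + 1)) + 1 / real (fib (k - r + 1))"
  proof -
    have ratio: "real (fib m) / real (fib k) \<le> 1 / real (fib (s + 1))" if "m + s = k" for m s
    proof -
      have "real (fib m) * real (fib (s + 1)) \<le> real (fib k)"
        using fib_mult_le[of m s] that by (metis of_nat_le_iff of_nat_mult)
      thus ?thesis using pos[of k] pos[of "s + 1"] assms by (simp add: field_simps)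
    qed
    have nn: "0 \<le> 1 / real (fib (r + 1))" "0 \<le> 1 / real (fib (k - r + 1))" by auto
    show ?thesis
    proof (cases "even (n div k)")
      case True
      hence "real G / real (fib k) \<le> 1 / real (fib (k - r + 1))"
        using ratio[of r "k - r"] r unfolding G_def by simp
      thus ?thesis using nn by linarith
    next
      case False
      hence "real G / real (fib k) \<le> 1 / real (fib (r + 1))"
        using ratio[of "k - r" r] r unfolding G_def by simp
      thus ?thesis using nn by linarith
    qed
  qed
  finally show ?thesis by (simp add: r_def)
qed

text \<open>
The sign depends on the parities of \<open>k\<close>, \<open>r\<close>, \<open>q\<close> and \<open>q div 2\<close> only, and the parity of \<open>n\<close>
determines that of \<open>r\<close> from those of \<open>k\<close> and \<open>q\<close>.
\<close>

lemma wraps_below_iff: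
  "wraps_below n k \<longleftrightarrow>
     (if even n then (if odd k then n div k mod 4 \<in> {2, 3} else odd (n div k))
      else odd k \<and> n div k mod 4 \<in> {1, 2})"
proof -
  define q r where "q = n div k" and "r = n mod k"
  have "n = q * k + r" by (simp add: q_def r_def)
  hence par: "even n \<longleftrightarrow> (even q \<or> even k) = even r" by (metis even_add even_mult_iff)
  have "(q mod 4 = 0 \<and> even q \<and> even (q div 2)) \<or> (q mod 4 = 1 \<and> odd q \<and> even (q div 2)) \<or>
    (q mod 4 = 2 \<and> even q \<and> odd (q div 2)) \<or> (q mod 4 = 3 \<and> odd q \<and> odd (q div 2))"
    by presburger
  thus ?thesis
    unfolding wraps_below_def Let_def q_def[symmetric] r_def[symmetric] par
    by (elim disjE conjE) (simp_all only: even_mult_iff even_add, auto)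
qed

section \<open>Jacobi's two-square theorem\<close>

text \<open>
The non-principal Dirichlet character modulo \<open>4\<close>.
\<close>

definition chi4 :: "nat \<Rightarrow> int" where
  "chi4 d = (if d mod 4 = 1 then 1 else if d mod 4 = 3 then -1 else 0)"

definition chi4_divisor_sum :: "nat \<Rightarrow> int" where
  "chi4_divisor_sum m = (\<Sum>d | d dvd m. chi4 d)"

lemma chi4_mult: "chi4 (a * b) = chi4 a * chi4 b"
proof -
  have "a * b mod 4 = (a mod 4) * (b mod 4) mod 4" by (simp add: mod_mult_eq)
  moreover have "a mod 4 \<in> {0, 1, 2, 3}" "b mod 4 \<in> {0, 1, 2, 3}" by auto
  ultimately show ?thesis
    unfolding chi4_def by (elim insertE emptyE) simp_all
qed

text \<open>
The Hecke relation at \<open>p\<close>: the divisors of \<open>p m\<close> are the divisors of \<open>m\<close> and \<open>p\<close> times these,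
and those counted twice are \<open>p\<close> times the divisors of \<open>m / p\<close>.
\<close>

lemma chi4_divisor_sum_prime_mult:
  assumes "prime p" "m > 0"
  shows "chi4_divisor_sum (p * m) = (1 + chi4 p) * chi4_divisor_sum m -
           (if p dvd m then chi4 p * chi4_divisor_sum (m div p) else 0)"
proof -
  let ?D = "\<lambda>n::nat. {d. d dvd n}"
  have p: "p > 0" using assms(1) by (simp add: prime_gt_0_nat)
  have inj: "inj_on ((*) p) A" for A using p by (auto simp: inj_on_def)
  have img: "sum chi4 ((*) p ` A) = chi4 p * sum chi4 A" for A
    by (simp add: sum.reindex[OF inj] chi4_mult sum_distrib_left)
  have un: "?D (p * m) = ?D m \<union> (*) p ` ?D m"
  proof (intro equalityI subsetI)
    fix d assume "d \<in> ?D (p * m)"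
    then obtain b c where bc: "d = b * c" "b dvd p" "c dvd m"
      using division_decomp[of d p m] by auto
    have "b = 1 \<or> b = p" using assms(1) bc(2) by (simp add: prime_nat_iff)
    thus "d \<in> ?D m \<union> (*) p ` ?D m" using bc by auto
  qed auto
  have int: "?D m \<inter> (*) p ` ?D m = (if p dvd m then (*) p ` ?D (m div p) else {})"
  proof (cases "p dvd m")
    case True
    then obtain l where l: "m = p * l" ..
    have "p * e dvd m \<longleftrightarrow> e dvd l" for e using p by (simp add: l)
    thus ?thesis using True l p by (auto simp: image_iff)
  next
    case False
    thus ?thesis by (auto dest: dvd_mult_left)
  qed
  have "sum chi4 (?D (p * m)) = sum chi4 (?D m) + sum chi4 ((*) p ` ?D m)
          - sum chi4 (?D m \<inter> (*) p ` ?D m)"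
    unfolding un using assms by (intro sum_Un) auto
  also have "sum chi4 (?D m \<inter> (*) p ` ?D m) =
      (if p dvd m then chi4 p * sum chi4 (?D (m div p)) else 0)"
    unfolding int by (simp add: img)
  finally show ?thesis
    unfolding chi4_divisor_sum_def img by (simp add: distrib_right)
qed

definition circle_points :: "nat \<Rightarrow> (int \<times> int) set" where
  "circle_points m = {(a, b). a\<^sup>2 + b\<^sup>2 = int m}"

lemma finite_circle_points: "finite (circle_points m)"
proof (rule finite_subset)
  have bound: "\<bar>a\<bar> \<le> int m" if "a\<^sup>2 + b\<^sup>2 = int m" for a b :: int
  proof -
    have "\<bar>a\<bar> \<le> \<bar>a\<bar> * \<bar>a\<bar>" using mult_left_mono[of 1 "\<bar>a\<bar>" "\<bar>a\<bar>"] by (cases "a = 0") auto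
    also have "\<dots> = a\<^sup>2" by (simp add: power2_eq_square)
    also have "\<dots> \<le> int m" using that zero_le_power2[of b] by linarith
    finally show ?thesis .
  qed
  show "circle_points m \<subseteq> {- int m..int m} \<times> {- int m..int m}"
  proof
    fix z assume z: "z \<in> circle_points m"
    obtain a b where ab: "z = (a, b)" by (cases z)
    have "a\<^sup>2 + b\<^sup>2 = int m" "b\<^sup>2 + a\<^sup>2 = int m" by (use z ab in \<open>simp_all add: circle_points_def\<close>)
    from this[THEN bound] show "z \<in> {- int m..int m} \<times> {- int m..int m}"
      by (simp add: ab abs_le_iff)
  qed
qed auto

text \<open>
In Gaussian integers: multiplication by the prime \<open>\<pi> = u + v i\<close> of norm \<open>p\<close> is a bijection from
the elements of norm \<open>m\<close> onto the multiples of \<open>\<pi>\<close> of norm \<open>p m\<close>. An element \<open>z = x + y i\<close> of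
norm \<open>p m\<close> is a multiple of \<open>\<pi>\<close> as soon as \<open>p\<close> divides the real part of \<open>z\<close> times the
conjugate of \<open>\<pi>\<close>, because that product has norm \<open>p\<^sup>2 m\<close>, so \<open>p\<close> divides its imaginary part too.
\<close>

lemma card_circle_points_divisible_by_factor:
  fixes u v :: int
  assumes "prime p" "u\<^sup>2 + v\<^sup>2 = int p"
  shows "card {(x, y) \<in> circle_points (p * m). int p dvd u * x + v * y} = card (circle_points m)"
proof -
  have p: "int p > 0" using assms(1) by (simp add: prime_gt_0_nat)
  have pp: "prime (int p)" using assms(1) by simp
  define f where "f = (\<lambda>(a, b). (u * a - v * b, u * b + v * a))"
  have norm: "(u * a - v * b)\<^sup>2 + (u * b + v * a)\<^sup>2 = int p * (a\<^sup>2 + b\<^sup>2)" for a b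
    unfolding assms(2)[symmetric] by (simp add: algebra_simps power2_eq_square)
  have inv1: "u * (u * a - v * b) + v * (u * b + v * a) = int p * a" for a b
    unfolding assms(2)[symmetric] by (simp add: algebra_simps power2_eq_square)
  have inv2: "u * (u * b + v * a) - v * (u * a - v * b) = int p * b" for a b
    unfolding assms(2)[symmetric] by (simp add: algebra_simps power2_eq_square)
  have "bij_betw f (circle_points m) {(x, y) \<in> circle_points (p * m). int p dvd u * x + v * y}"
    unfolding bij_betw_def
  proof (intro conjI equalityI subsetI)
    show "inj_on f (circle_points m)"
    proof (rule inj_onI)
      fix z w assume "f z = f w"
      obtain a b c d where zw: "z = (a, b)" "w = (c, d)" by (cases z, cases w)
      with \<open>f z = f w\<close> have eq: "u * a - v * b = u * c - v * d" "u * b + v * a = u * d + v * c"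
        by (simp_all add: f_def)
      have "int p * a = int p * c" by (metis inv1 eq)
      moreover have "int p * b = int p * d" by (metis inv2 eq)
      ultimately show "z = w" using p zw by simp
    qed
  next
    fix z assume "z \<in> f ` circle_points m"
    then obtain a b where ab: "(a, b) \<in> circle_points m" "z = f (a, b)" by force
    have "f (a, b) \<in> circle_points (p * m)"
      using ab(1) norm[of a b] by (simp add: f_def circle_points_def)
    moreover have "int p dvd u * (u * a - v * b) + v * (u * b + v * a)"
      unfolding inv1 by simp
    ultimately show "z \<in> {(x, y) \<in> circle_points (p * m). int p dvd u * x + v * y}"
      by (simp add: ab(2) f_def)
  next
    fix z assume z: "z \<in> {(x, y) \<in> circle_points (p * m). int p dvd u * x + v * y}"
    obtain x y where xy: "z = (x, y)" by (cases z)
    from z xy have n: "x\<^sup>2 + y\<^sup>2 = int p * int m" and d1: "int p dvd u * x + v * y"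
      by (auto simp: circle_points_def)
    have id: "(u * x + v * y)\<^sup>2 + (u * y - v * x)\<^sup>2 = int p * (x\<^sup>2 + y\<^sup>2)"
      unfolding assms(2)[symmetric] by (simp add: algebra_simps power2_eq_square)
    have "(u * y - v * x)\<^sup>2 = int p * (x\<^sup>2 + y\<^sup>2) - (u * x + v * y)\<^sup>2" using id by simp
    moreover have "int p dvd int p * (x\<^sup>2 + y\<^sup>2) - (u * x + v * y)\<^sup>2"
      using d1 by (simp add: power2_eq_square)
    ultimately have "int p dvd (u * y - v * x)\<^sup>2" by simp
    hence "int p dvd u * y - v * x" using pp prime_dvd_power by blast
    with d1 obtain a b where ab: "u * x + v * y = int p * a" "u * y - v * x = int p * b"
      by (meson dvdE)
    have "int p * (u * a - v * b) = int p * x"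
    proof -
      have "int p * (u * a - v * b) = u * (int p * a) - v * (int p * b)" by (simp add: algebra_simps)
      also have "\<dots> = (u\<^sup>2 + v\<^sup>2) * x"
        unfolding ab[symmetric] by (simp add: algebra_simps power2_eq_square)
      finally show ?thesis by (simp add: assms(2))
    qed
    moreover have "int p * (u * b + v * a) = int p * y"
    proof -
      have "int p * (u * b + v * a) = u * (int p * b) + v * (int p * a)" by (simp add: algebra_simps)
      also have "\<dots> = (u\<^sup>2 + v\<^sup>2) * y"
        unfolding ab[symmetric] by (simp add: algebra_simps power2_eq_square)
      finally show ?thesis by (simp add: assms(2))
    qed
    ultimately have f: "f (a, b) = z" using p xy by (simp add: f_def)
    have "int p * (a\<^sup>2 + b\<^sup>2) = int p * int m"
      using norm[of a b] f xy n by (auto simp: f_def)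
    hence "(a, b) \<in> circle_points m" using p by (simp add: circle_points_def)
    thus "z \<in> f ` circle_points m" using f by blast
  qed
  from bij_betw_same_card[OF this] show ?thesis by (rule sym)
qed

lemma card_circle_points_divisible:
  assumes "prime p" "m > 0"
  shows "card {(x, y) \<in> circle_points (p * m). int p dvd x \<and> int p dvd y} =
           (if p dvd m then card (circle_points (m div p)) else 0)"
proof -
  have p: "int p > 0" using assms(1) by (simp add: prime_gt_0_nat)
  let ?S = "{(x, y) \<in> circle_points (p * m). int p dvd x \<and> int p dvd y}"
  have sq: "(int p * a)\<^sup>2 + (int p * b)\<^sup>2 = int (p * m) \<longleftrightarrow> int p * (a\<^sup>2 + b\<^sup>2) = int m" for a b
  proof -
    have "(int p * a)\<^sup>2 + (int p * b)\<^sup>2 = int p * (int p * (a\<^sup>2 + b\<^sup>2))"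
      by (simp add: algebra_simps power2_eq_square)
    thus ?thesis using p by simp
  qed
  show ?thesis
  proof (cases "p dvd m")
    case True
    then obtain l where l: "m = p * l" ..
    have "bij_betw (\<lambda>(a, b). (int p * a, int p * b)) (circle_points l) ?S"
      unfolding bij_betw_def
    proof (intro conjI equalityI subsetI)
      show "inj_on (\<lambda>(a, b). (int p * a, int p * b)) (circle_points l)"
        using p by (auto simp: inj_on_def)
    next
      fix z assume "z \<in> (\<lambda>(a, b). (int p * a, int p * b)) ` circle_points l"
      then obtain a b where ab: "z = (int p * a, int p * b)" "a\<^sup>2 + b\<^sup>2 = int l"
        by (auto simp: circle_points_def)
      thus "z \<in> ?S" using sq[of a b] by (simp add: circle_points_def l)
    next
      fix z assume "z \<in> ?S"
      then obtain x y where xy: "z = (x, y)" "x\<^sup>2 + y\<^sup>2 = int (p * m)" "int p dvd x" "int p dvd y"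
        by (auto simp: circle_points_def)
      then obtain a b where "x = int p * a" "y = int p * b" by (meson dvdE)
      with xy have ab: "z = (int p * a, int p * b)"
          "(int p * a)\<^sup>2 + (int p * b)\<^sup>2 = int (p * m)" by simp_all
      hence "(a, b) \<in> circle_points l" using sq[of a b] p by (simp add: circle_points_def l)
      thus "z \<in> (\<lambda>(a, b). (int p * a, int p * b)) ` circle_points l"
        by (rule rev_image_eqI) (simp add: ab(1))
    qed
    from bij_betw_same_card[OF this]
    have "card ?S = card (circle_points l)" by (rule sym)
    thus ?thesis using True l p by simp
  next
    case False
    have "?S = {}"
    proof (rule equals0I)
      fix z assume "z \<in> ?S"
      then obtain x y where xy: "x\<^sup>2 + y\<^sup>2 = int (p * m)" "int p dvd x" "int p dvd y"
        by (auto simp: circle_points_def)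
      then obtain a b where "x = int p * a" "y = int p * b" by (meson dvdE)
      with xy have "(int p * a)\<^sup>2 + (int p * b)\<^sup>2 = int (p * m)" by simp
      hence "int p dvd int m" unfolding sq by (metis dvd_triv_left)
      thus False using False by simp
    qed
    thus ?thesis using False by (simp only: card.empty if_False)
  qed
qed

text \<open>
Otherwise \<open>x\<^sup>2 \<equiv> - y\<^sup>2\<close> with \<open>x\<close>, \<open>y\<close> invertible. Raising this to the odd power
\<open>(p - 1) / 2\<close> contradicts Fermat's little theorem.
\<close>

lemma prime_3_mod_4_dvd_sum_squares:
  fixes x y :: int
  assumes "prime p" "p mod 4 = 3" "int p dvd x\<^sup>2 + y\<^sup>2"
  shows "int p dvd x"
proof (rule ccontr)
  assume nx: "\<not> int p dvd x"
  have pp: "prime (int p)" using assms(1) by simp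
  have ny: "\<not> int p dvd y"
  proof
    assume "int p dvd y"
    hence "int p dvd y\<^sup>2" by (simp add: power2_eq_square)
    with assms(3) have "int p dvd x\<^sup>2" by (simp add: dvd_add_left_iff)
    thus False using nx pp prime_dvd_power by blast
  qed
  define h where "h = (p - 1) div 2"
  have h: "odd h" "p - 1 = 2 * h"
  proof -
    obtain t where "p = 4 * t + 3" using assms(2) by (metis mod_mult_div_eq mult.commute add.commute)
    thus "odd h" "p - 1 = 2 * h" by (simp_all add: h_def)
  qed
  have flt: "[z ^ (p - 1) = 1] (mod int p)" if "\<not> int p dvd z" for z :: int
  proof -
    define w where "w = nat (z mod int p)"
    have w: "int w = z mod int p" using assms(1) by (simp add: w_def prime_gt_0_nat)
    have "\<not> int p dvd int w" using that unfolding w by (simp add: dvd_mod_iff)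
    hence "\<not> p dvd w" by simp
    from fermat_theorem[OF assms(1) this] have "[int w ^ (p - 1) = 1] (mod int p)"
      by (metis cong_int_iff of_nat_1 of_nat_power)
    moreover have "[int w ^ (p - 1) = z ^ (p - 1)] (mod int p)"
      unfolding w by (intro cong_pow) simp
    ultimately show ?thesis using cong_sym cong_trans by blast
  qed
  have "[x\<^sup>2 = - (y\<^sup>2)] (mod int p)" using assms(3) by (simp add: cong_iff_dvd_diff)
  hence "[(x\<^sup>2) ^ h = (- (y\<^sup>2)) ^ h] (mod int p)" by (rule cong_pow)
  hence "[x ^ (p - 1) = - (y ^ (p - 1))] (mod int p)"
    using h by (simp add: power_mult)
  moreover have "[- (y ^ (p - 1)) = - 1] (mod int p)"
    using flt[OF ny] by (simp add: cong_minus_minus_iff)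
  ultimately have "[1 = - 1] (mod int p)"
    using flt[OF nx] by (meson cong_sym cong_trans)
  hence "int p dvd 2" by (simp add: cong_iff_dvd_diff)
  hence "p \<le> 2" using zdvd_imp_le by fastforce
  thus False using assms(2) by (cases "p = 2"; cases "p = 1"; cases "p = 0") auto
qed

text \<open>
Thue's argument: let \<open>s\<^sup>2 \<equiv> -1\<close> modulo \<open>p\<close>. There are more than \<open>p\<close> pairs \<open>(i, j)\<close> with
entries up to \<open>\<surd>p\<close>, so two of them share the residue of \<open>i - s j\<close>. Their difference \<open>(u, v)\<close>
has \<open>0 < u\<^sup>2 + v\<^sup>2 < 2 p\<close> with \<open>p\<close> dividing \<open>u\<^sup>2 + v\<^sup>2\<close>.
\<close>

lemma prime_1_mod_4_sum_squares:
  assumes "prime p" "p mod 4 = 1"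
  obtains u v :: int where "u\<^sup>2 + v\<^sup>2 = int p"
proof -
  have p2: "p > 2" using assms prime_ge_2_nat[of p] by (cases "p = 2") auto
  have pp: "prime (int p)" using assms(1) by simp
  have "[Legendre (-1) (int p) = (-1) ^ ((p - 1) div 2)] (mod int p)"
    by (rule euler_criterion[OF assms(1) p2])
  moreover have "even ((p - 1) div 2)"
  proof -
    obtain t where "p = 4 * t + 1" using assms(2) by (metis mod_mult_div_eq mult.commute add.commute)
    thus ?thesis by simp
  qed
  ultimately have "[Legendre (-1) (int p) = 1] (mod int p)" by simp
  moreover have "\<not> [0 = 1] (mod int p)" "\<not> [-1 = 1] (mod int p)"
    using p2 zdvd_imp_le[of "int p" 2] zdvd_imp_le[of "int p" 1] by (auto simp: cong_iff_dvd_diff)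
  ultimately have "QuadRes (int p) (-1)" by (auto simp: Legendre_def split: if_splits)
  then obtain s where s: "[s\<^sup>2 = - 1] (mod int p)" by (auto simp: QuadRes_def)
  define m where "m = nat \<lfloor>sqrt (real p)\<rfloor>"
  have m_le: "m * m \<le> p"
  proof -
    have "real m \<le> sqrt (real p)" by (simp add: m_def)
    hence "real m * real m \<le> sqrt (real p) * sqrt (real p)" by (intro mult_mono) auto
    thus ?thesis by (metis abs_of_nat of_nat_le_iff of_nat_mult real_sqrt_mult_self)
  qed
  have lt_m: "p < Suc m * Suc m"
  proof -
    have "sqrt (real p) < real (Suc m)" unfolding m_def by linarith
    hence "sqrt (real p) * sqrt (real p) < real (Suc m) * real (Suc m)"
      by (intro mult_strict_mono) auto
    thus ?thesis by (metis abs_of_nat of_nat_less_iff of_nat_mult real_sqrt_mult_self)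
  qed
  \<comment> \<open>A prime is not a square; this strictness gives \<open>u\<^sup>2 + v\<^sup>2 < 2 p\<close>, which excludes \<open>2 p\<close>.\<close>
  have m_lt: "m * m < p"
  proof -
    have "m * m \<noteq> p"
    proof
      assume "m * m = p"
      hence "m = 1 \<or> m = p" using assms(1) by (metis dvd_triv_left prime_nat_iff)
      thus False using \<open>m * m = p\<close> p2 by auto
    qed
    thus ?thesis using m_le by simp
  qed
  let ?B = "{0..m} \<times> {0..m}"
  define g where "g = (\<lambda>(i, j). (int i - s * int j) mod int p)"
  have "g ` ?B \<subseteq> {0..<int p}" using p2 by (auto simp: g_def)
  hence "card (g ` ?B) \<le> p" using card_mono[of "{0..<int p}" "g ` ?B"] by simp
  also have "\<dots> < card ?B" using lt_m by (simp add: card_cartesian_product)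
  finally have "\<not> inj_on g ?B" by (rule pigeonhole)
  then obtain z w where zw: "z \<in> ?B" "w \<in> ?B" "g z = g w" "z \<noteq> w"
    unfolding inj_on_def by blast
  obtain i j k l where ij: "z = (i, j)" "w = (k, l)" by (cases z, cases w)
  have ne: "(i, j) \<noteq> (k, l)" and eq: "g (i, j) = g (k, l)"
    and mem: "i \<le> m" "j \<le> m" "k \<le> m" "l \<le> m" using zw ij by simp_all
  define u v where "u = int i - int k" and "v = int j - int l"
  have "int p dvd u - s * v"
    using eq by (simp add: g_def u_def v_def mod_eq_dvd_iff algebra_simps)
  moreover have "u\<^sup>2 + v\<^sup>2 = (u - s * v) * (u + s * v) + (s\<^sup>2 - (-1)) * v\<^sup>2"
    by (simp add: algebra_simps power2_eq_square)
  moreover have "int p dvd s\<^sup>2 - (-1)" using s by (simp only: cong_iff_dvd_diff)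
  ultimately have dvd: "int p dvd u\<^sup>2 + v\<^sup>2" by (metis dvd_add dvd_mult2)
  have bound: "w\<^sup>2 < int p" if "\<bar>w\<bar> \<le> int m" for w :: int
  proof -
    have "\<bar>w\<bar> * \<bar>w\<bar> \<le> int m * int m" using that by (intro mult_mono) auto
    also have "\<dots> < int p" using m_lt by (metis of_nat_less_iff of_nat_mult)
    finally show ?thesis by (simp add: power2_eq_square)
  qed
  have "\<bar>u\<bar> \<le> int m" "\<bar>v\<bar> \<le> int m" using mem by (auto simp: u_def v_def)
  hence lt: "u\<^sup>2 + v\<^sup>2 < 2 * int p" using bound[of u] bound[of v] by simp
  have pos: "0 < u\<^sup>2 + v\<^sup>2" using ne by (auto simp: u_def v_def sum_power2_gt_zero_iff)
  obtain t where t: "u\<^sup>2 + v\<^sup>2 = int p * t" using dvd ..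
  have "0 < t" using pos t p2 by (simp add: zero_less_mult_iff)
  moreover have "t < 2" using lt t p2 by (simp add: mult.commute)
  ultimately have "t = 1" by simp
  thus ?thesis using that t by simp
qed

text \<open>
The number of representations satisfies the same Hecke relation as the divisor sum of \<open>chi4\<close>.
The prime \<open>2\<close> ramifies, so every element of norm \<open>2 m\<close> is divisible by \<open>1 + i\<close>. For \<open>p \<equiv> 1\<close> modulo \<open>4\<close> every
element of norm \<open>p m\<close> is divisible by one of the two conjugate primes above \<open>p\<close>, and by both
exactly if it is divisible by \<open>p\<close>; this is inclusion and exclusion. For \<open>p \<equiv> 3\<close> modulo \<open>4\<close>
everything of norm \<open>p m\<close> is divisible by \<open>p\<close>.
\<close>

lemma card_circle_points_prime_mult:
  assumes "prime p" "m > 0"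
  shows "int (card (circle_points (p * m))) = (1 + chi4 p) * int (card (circle_points m)) -
           (if p dvd m then chi4 p * int (card (circle_points (m div p))) else 0)"
proof -
  have pp: "prime (int p)" using assms(1) by simp
  consider "p = 2" | "p mod 4 = 1" | "p mod 4 = 3"
  proof -
    have "p = 2 \<or> odd p" using assms(1) prime_odd_nat prime_ge_2_nat[OF assms(1)] by fastforce
    moreover have "p mod 4 = 1 \<or> p mod 4 = 3" if "odd p" using that by presburger
    ultimately show ?thesis using that by blast
  qed
  thus ?thesis
  proof cases
    case 1
    have ev: "even (x + y)" if "x\<^sup>2 + y\<^sup>2 = 2 * int m" for x y :: int
    proof -
      have "even (x\<^sup>2 + y\<^sup>2)" using that by simp
      thus ?thesis by simp
    qed
    have "{(x, y) \<in> circle_points (2 * m). int 2 dvd 1 * x + 1 * y} = circle_points (2 * m)"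
      using ev by (auto simp: circle_points_def)
    moreover have "card {(x, y) \<in> circle_points (2 * m). int 2 dvd 1 * x + 1 * y} = card (circle_points m)"
      by (rule card_circle_points_divisible_by_factor) auto
    ultimately show ?thesis using 1 by (simp add: chi4_def)
  next
    case 2
    obtain u v :: int where uv: "u\<^sup>2 + v\<^sup>2 = int p"
      using prime_1_mod_4_sum_squares[OF assms(1) 2] .
    let ?S = "circle_points (p * m)"
    let ?A = "{(x, y) \<in> ?S. int p dvd u * x + v * y}"
    let ?B = "{(x, y) \<in> ?S. int p dvd u * x + (-v) * y}"
    have p2: "p > 2" using assms 2 prime_ge_2_nat[of p] by (cases "p = 2") auto
    have not2: "\<not> int p dvd 2" using p2 zdvd_imp_le[of "int p" 2] by auto
    have small: "\<not> int p dvd w" if "w\<^sup>2 < int p" "w \<noteq> 0" for w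
    proof
      assume "int p dvd w"
      hence "int p dvd w\<^sup>2" by (simp add: power2_eq_square)
      hence "int p \<le> w\<^sup>2" using that by (intro zdvd_imp_le) auto
      thus False using that by simp
    qed
    have nsq: "w\<^sup>2 \<noteq> int p" for w
    proof
      assume eq: "w\<^sup>2 = int p"
      hence "int p dvd w" using pp prime_dvd_power[of "int p" w 2] by simp
      then obtain c where "w = int p * c" ..
      hence "int p * (int p * c\<^sup>2) = int p * 1" using eq by (simp add: power2_eq_square algebra_simps)
      hence "int p dvd 1" using p2 by (metis dvd_triv_left mult_cancel_left of_nat_0_eq_iff not_less_zero)
      thus False using p2 by simp
    qed
    have u0: "u \<noteq> 0" "v \<noteq> 0" using nsq[of v] nsq[of u] uv by auto
    have "u\<^sup>2 < int p" "v\<^sup>2 < int p" using uv u0 by (smt (verit) zero_less_power2)+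
    hence ndu: "\<not> int p dvd u" "\<not> int p dvd v" using small u0 by auto
    have "card ?A = card (circle_points m)"
      by (rule card_circle_points_divisible_by_factor[OF assms(1) uv])
    moreover have "card ?B = card (circle_points m)"
      by (rule card_circle_points_divisible_by_factor[OF assms(1)]) (simp add: uv)
    moreover have "?A \<inter> ?B = {(x, y) \<in> ?S. int p dvd x \<and> int p dvd y}"
    proof -
      have "int p dvd x \<and> int p dvd y" if "int p dvd u * x + v * y" "int p dvd u * x + (-v) * y" for x y
      proof -
        have "int p dvd 2 * (u * x)" "int p dvd 2 * (v * y)"
          using dvd_add[OF that] dvd_diff[OF that] by simp_all
        thus ?thesis using not2 ndu pp by (auto simp: prime_dvd_mult_iff)
      qed
      moreover have "int p dvd u * x + v * y \<and> int p dvd u * x + (-v) * y"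
        if "int p dvd x \<and> int p dvd y" for x y using that by (simp add: dvd_add)
      ultimately show ?thesis by blast
    qed
    moreover have "?A \<union> ?B = ?S"
    proof -
      have "int p dvd u * x + v * y \<or> int p dvd u * x + (-v) * y" if "x\<^sup>2 + y\<^sup>2 = int p * int m" for x y
      proof -
        have "(u * x + v * y) * (u * x + (-v) * y) = u\<^sup>2 * (x\<^sup>2 + y\<^sup>2) - (u\<^sup>2 + v\<^sup>2) * y\<^sup>2"
          by (simp add: algebra_simps power2_eq_square)
        hence "int p dvd (u * x + v * y) * (u * x + (-v) * y)" unfolding that uv by simp
        thus ?thesis using pp prime_dvd_multD by blast
      qed
      thus ?thesis by (auto simp: circle_points_def)
    qed
    moreover have "card ?A + card ?B = card (?A \<union> ?B) + card (?A \<inter> ?B)"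
      by (rule card_Un_Int) (rule finite_subset[OF _ finite_circle_points[of "p * m"]], blast)+
    ultimately have "card (circle_points m) + card (circle_points m) =
        card ?S + (if p dvd m then card (circle_points (m div p)) else 0)"
      using card_circle_points_divisible[OF assms] by simp
    thus ?thesis using 2 by (auto simp: chi4_def split: if_splits)
  next
    case 3
    have "int p dvd x \<and> int p dvd y" if "x\<^sup>2 + y\<^sup>2 = int p * int m" for x y
      using prime_3_mod_4_dvd_sum_squares[OF assms(1) 3, of x y]
        prime_3_mod_4_dvd_sum_squares[OF assms(1) 3, of y x] that by (simp add: add.commute)
    hence "{(x, y) \<in> circle_points (p * m). int p dvd x \<and> int p dvd y} = circle_points (p * m)"
      by (auto simp: circle_points_def)
    thus ?thesis using card_circle_points_divisible[OF assms] 3 by (simp add: chi4_def)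
  qed
qed

lemma circle_points_1: "circle_points 1 = {(1, 0), (-1, 0), (0, 1), (0, -1)}"
proof -
  have "(a, b) \<in> {(1, 0), (-1, 0), (0, 1), (0, -1)}" if "a\<^sup>2 + b\<^sup>2 = 1" for a b :: int
  proof -
    have "a\<^sup>2 \<le> 1" "b\<^sup>2 \<le> 1" using that zero_le_power2[of a] zero_le_power2[of b] by linarith+
    hence "\<bar>a\<bar> \<le> 1" "\<bar>b\<bar> \<le> 1" by (simp_all add: abs_square_le_1)
    hence "a \<in> {-1, 0, 1}" "b \<in> {-1, 0, 1}" by auto
    thus ?thesis using that by auto
  qed
  thus ?thesis by (auto simp: circle_points_def)
qed

text \<open>
Jacobi's two-square theorem. Both sides agree at \<open>m = 1\<close> and obey the same Hecke relation at every
prime, which determines them.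
\<close>

theorem card_circle_points:
  assumes "m > 0"
  shows "int (card (circle_points m)) = 4 * chi4_divisor_sum m"
  using assms
proof (induction m rule: less_induct)
  case (less m)
  show ?case
  proof (cases "m = 1")
    case True
    have "{d::nat. d dvd 1} = {1}" by auto
    thus ?thesis unfolding True circle_points_1 chi4_divisor_sum_def by (simp add: chi4_def)
  next
    case False
    then obtain p where p: "prime p" "p dvd m" using prime_factor_nat by blast
    then obtain l where l: "m = p * l" by auto
    have p2: "p \<ge> 2" using p(1) by (rule prime_ge_2_nat)
    have l0: "l > 0" "l < m" using l less.prems p2 by auto
    have IH: "int (card (circle_points l)) = 4 * chi4_divisor_sum l"
      by (rule less.IH) (use l0 in auto)
    have IH': "int (card (circle_points (l div p))) = 4 * chi4_divisor_sum (l div p)" if "p dvd l"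
    proof (rule less.IH)
      show "l div p < m" using l0 by (meson div_le_dividend le_less_trans)
      show "0 < l div p" using that l0 p2 by (simp add: dvd_imp_le div_greater_zero_iff)
    qed
    show ?thesis
      unfolding l card_circle_points_prime_mult[OF p(1) l0(1)] chi4_divisor_sum_prime_mult[OF p(1) l0(1)] IH
      using IH' by (simp add: algebra_simps)
  qed
qed

section \<open>Lattice point counts and Dirichlet's divisor estimate\<close>

text \<open>
If \<open>f\<close> is the summatory function of \<open>g\<close>, this is the sum of \<open>g d\<close> over all pairs \<open>(k, d)\<close> of
positive integers with \<open>k d \<le> N\<close>. The lattice point counts for the disc and the
hyperbola both reduce to this form.
\<close>

definition quotient_sum :: "(nat \<Rightarrow> real) \<Rightarrow> nat \<Rightarrow> real" where
  "quotient_sum f N = (\<Sum>k=1..N. f (N div k))"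

lemma quotient_sum_extend:
  assumes "f 0 = 0" "N \<le> M"
  shows "(\<Sum>k=1..M. f (N div k)) = quotient_sum f N"
  unfolding quotient_sum_def
  by (rule sum.mono_neutral_right) (use assms in auto)

text \<open>
Since \<open>N div k div c = (N div c) div k\<close>, and the terms with \<open>k > N div c\<close> vanish.
\<close>

lemma quotient_sum_div:
  assumes "f 0 = 0"
  shows "quotient_sum (\<lambda>q. f (q div c)) N = quotient_sum f (N div c)"
proof -
  have "quotient_sum (\<lambda>q. f (q div c)) N = (\<Sum>k=1..N. f (N div c div k))"
    by (simp add: quotient_sum_def flip: div_mult2_eq, simp add: mult.commute)
  also have "\<dots> = quotient_sum f (N div c)"
    by (rule quotient_sum_extend) (use assms in auto)
  finally show ?thesis .
qed

lemma quotient_sum_even: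
  "(\<Sum>k=1..N. if even k then f (N div k) else 0) = quotient_sum f (N div 2)"
proof -
  have "(\<Sum>k=1..N. if even k then f (N div k) else 0) = (\<Sum>k | k \<in> {1..N} \<and> even k. f (N div k))"
    by (rule sum.inter_filter[symmetric]) simp
  also have "{k. k \<in> {1..N} \<and> even k} = (*) 2 ` {1..N div 2}"
    by (auto simp: image_iff elim!: evenE)
  also have "(\<Sum>k\<in>(*) 2 ` {1..N div 2}. f (N div k)) = quotient_sum f (N div 2)"
    unfolding quotient_sum_def by (subst sum.reindex) (auto simp: inj_on_def div_mult2_eq)
  finally show ?thesis .
qed

lemma quotient_sum_linear:
  "quotient_sum (\<lambda>q. a * f q + b * g q) N = a * quotient_sum f N + b * quotient_sum g N"
  by (simp add: quotient_sum_def sum.distrib sum_distrib_left)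

lemma of_nat_le_iff_nat_floor: "x \<ge> 0 \<Longrightarrow> real n \<le> x \<longleftrightarrow> n \<le> nat \<lfloor>x\<rfloor>"
  by linarith

lemma card_hyperbola_points:
  "real (card (SIGMA a:{1..N}. {1..N div a})) = quotient_sum real N"
  by (simp add: quotient_sum_def)

lemma N_H_eq_quotient_sum:
  assumes "x \<ge> 0"
  shows "real (N_H x) = quotient_sum real (nat \<lfloor>x\<rfloor>)"
proof -
  let ?N = "nat \<lfloor>x\<rfloor>"
  have "{(a, b). 1 \<le> a \<and> 1 \<le> b \<and> real (a * b) \<le> x} = (SIGMA a:{1..?N}. {1..?N div a})"
  proof (intro equalityI subsetI)
    fix z assume "z \<in> {(a, b). 1 \<le> a \<and> 1 \<le> b \<and> real (a * b) \<le> x}"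
    then obtain a b where z: "z = (a, b)" "1 \<le> a" "1 \<le> b" "real (a * b) \<le> x" by blast
    hence ab: "z = (a, b)" "1 \<le> a" "1 \<le> b" "a * b \<le> ?N"
      using of_nat_le_iff_nat_floor[OF assms] by blast+
    have "a \<le> a * b" using ab by simp
    hence "a \<le> ?N" using ab(4) by linarith
    thus "z \<in> (SIGMA a:{1..?N}. {1..?N div a})"
      using ab by (simp add: less_eq_div_iff_mult_less_eq mult.commute)
  next
    fix z assume "z \<in> (SIGMA a:{1..?N}. {1..?N div a})"
    then obtain a b where ab: "z = (a, b)" "1 \<le> a" "1 \<le> b" "a * b \<le> ?N"
      by (auto simp: less_eq_div_iff_mult_less_eq mult.commute)
    hence "real (a * b) \<le> x" using of_nat_le_iff_nat_floor[OF assms] by blast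
    thus "z \<in> {(a, b). 1 \<le> a \<and> 1 \<le> b \<and> real (a * b) \<le> x}" using ab by simp
  qed
  thus ?thesis unfolding N_H_def by (simp only: card_hyperbola_points)
qed

text \<open>
The summatory function of \<open>chi4\<close>, as \<open>sum_chi4\<close> shows.
\<close>

definition chi4_partial_sum :: "nat \<Rightarrow> real" where
  "chi4_partial_sum q = of_bool (q mod 4 \<in> {1, 2})"

lemma sum_chi4: "(\<Sum>d=1..q. real_of_int (chi4 d)) = chi4_partial_sum q"
proof (induction q)
  case (Suc q)
  have "q mod 4 = 0 \<or> q mod 4 = 1 \<or> q mod 4 = 2 \<or> q mod 4 = 3" by linarith
  moreover have "Suc q mod 4 = (if q mod 4 = 3 then 0 else Suc (q mod 4))" by (simp add: mod_Suc)
  ultimately show ?case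
    using Suc.IH by (elim disjE) (simp_all add: chi4_partial_sum_def chi4_def)
qed (simp add: chi4_partial_sum_def)

lemma sum_chi4_divisor_sum:
  "(\<Sum>m=1..N. real_of_int (chi4_divisor_sum m)) = quotient_sum chi4_partial_sum N"
proof -
  have "(\<Sum>m=1..N. real_of_int (chi4_divisor_sum m)) =
      (\<Sum>(m, d) \<in> (SIGMA m:{1..N}. {d. d dvd m}). real_of_int (chi4 d))"
    by (simp add: chi4_divisor_sum_def sum.Sigma)
  also have "\<dots> = (\<Sum>(k, d) \<in> (SIGMA k:{1..N}. {1..N div k}). real_of_int (chi4 d))"
  proof (rule sum.reindex_bij_witness[of _ "\<lambda>(k, d). (k * d, d)" "\<lambda>(m, d). (m div d, d)"])
    fix z assume "z \<in> (SIGMA m:{1..N}. {d. d dvd m})"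
    then obtain k d where z: "z = (k * d, d)" "1 \<le> k * d" "k * d \<le> N"
      by (auto elim!: dvdE simp: mult.commute)
    hence kd: "k \<ge> 1" "d \<ge> 1" by auto
    have "k \<le> k * d" using kd by simp
    hence "k \<le> N" using z(3) by linarith
    thus "(case z of (m, d) \<Rightarrow> (m div d, d)) \<in> (SIGMA k:{1..N}. {1..N div k})"
      using z kd by (simp add: less_eq_div_iff_mult_less_eq mult.commute)
    show "(case (case z of (m, d) \<Rightarrow> (m div d, d)) of (k, d) \<Rightarrow> (k * d, d)) = z"
      using z kd by simp
  next
    fix z assume "z \<in> (SIGMA k:{1..N}. {1..N div k})"
    then obtain k d where z: "z = (k, d)" "1 \<le> k" "1 \<le> d" "k * d \<le> N"
      by (auto simp: less_eq_div_iff_mult_less_eq mult.commute)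
    show "(case (case z of (k, d) \<Rightarrow> (k * d, d)) of (m, d) \<Rightarrow> (m div d, d)) = z"
      using z by simp
    show "(case z of (k, d) \<Rightarrow> (k * d, d)) \<in> (SIGMA m:{1..N}. {d. d dvd m})"
      using z by simp
  qed auto
  also have "\<dots> = quotient_sum chi4_partial_sum N"
    by (simp add: quotient_sum_def sum.Sigma[symmetric] flip: sum_chi4)
  finally show ?thesis .
qed

lemma N_C_eq_quotient_sum:
  assumes "x \<ge> 0"
  shows "real (N_C x) = 1 + 4 * quotient_sum chi4_partial_sum (nat \<lfloor>x\<rfloor>)"
proof -
  let ?N = "nat \<lfloor>x\<rfloor>"
  have eq: "{(a, b). real_of_int (a\<^sup>2 + b\<^sup>2) \<le> x} = (\<Union>m\<in>{0..?N}. circle_points m)"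
  proof (intro equalityI subsetI)
    fix z assume z: "z \<in> {(a, b). real_of_int (a\<^sup>2 + b\<^sup>2) \<le> x}"
    obtain a b where ab: "z = (a, b)" by (cases z)
    define m where "m = nat (a\<^sup>2 + b\<^sup>2)"
    have m: "int m = a\<^sup>2 + b\<^sup>2" by (simp add: m_def)
    have "real m \<le> x" using z ab m by (metis (no_types, lifting) case_prodD mem_Collect_eq of_int_of_nat_eq)
    hence "m \<in> {0..?N}" using of_nat_le_iff_nat_floor[OF assms] by simp
    moreover have "z \<in> circle_points m" using m ab by (simp add: circle_points_def)
    ultimately show "z \<in> (\<Union>m\<in>{0..?N}. circle_points m)" by blast
  next
    fix z assume "z \<in> (\<Union>m\<in>{0..?N}. circle_points m)"
    then obtain m a b where m: "m \<le> ?N" "z = (a, b)" "a\<^sup>2 + b\<^sup>2 = int m"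
      by (auto simp: circle_points_def)
    have "real_of_int (a\<^sup>2 + b\<^sup>2) \<le> x"
      unfolding m(3) using m(1) of_nat_le_iff_nat_floor[OF assms, of m] by simp
    thus "z \<in> {(a, b). real_of_int (a\<^sup>2 + b\<^sup>2) \<le> x}" using m(2) by simp
  qed
  have zero: "circle_points 0 = {(0, 0)}" by (auto simp: circle_points_def sum_power2_eq_zero_iff)
  have "N_C x = (\<Sum>m\<in>{0..?N}. card (circle_points m))"
    unfolding N_C_def eq
  proof (rule card_UN_disjoint)
    show "\<forall>m\<in>{0..?N}. \<forall>l\<in>{0..?N}. m \<noteq> l \<longrightarrow> circle_points m \<inter> circle_points l = {}"
      by (auto simp: circle_points_def)
  qed (simp_all add: finite_circle_points)
  also have "\<dots> = 1 + (\<Sum>m=1..?N. card (circle_points m))"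
    by (simp add: sum.atLeast_Suc_atMost zero)
  finally have "real (N_C x) = 1 + (\<Sum>m=1..?N. real (card (circle_points m)))" by simp
  also have "(\<Sum>m=1..?N. real (card (circle_points m))) =
      (\<Sum>m=1..?N. 4 * real_of_int (chi4_divisor_sum m))"
  proof (intro sum.cong refl)
    fix m assume "m \<in> {1..?N}"
    hence "int (card (circle_points m)) = 4 * chi4_divisor_sum m" by (intro card_circle_points) simp
    thus "real (card (circle_points m)) = 4 * real_of_int (chi4_divisor_sum m)" by linarith
  qed
  also have "\<dots> = 4 * quotient_sum chi4_partial_sum ?N"
    by (simp only: sum_chi4_divisor_sum flip: sum_distrib_left)
  finally show ?thesis .
qed

text \<open>
The difference \<open>R N - R (N div 2)\<close> is the sum of the divisor sums of \<open>chi4\<close> over odd \<open>m \<le> N\<close>,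
because these divisor sums agree at \<open>m\<close> and \<open>2 m\<close>. So it does not change from \<open>2 M - 1\<close> to \<open>2 M\<close>,
and information at odd arguments suffices.
\<close>

lemma quotient_sum_chi4_diff_even:
  assumes "M > 0"
  defines "R \<equiv> quotient_sum chi4_partial_sum"
  shows "R (2 * M) - R M = R (2 * M - 1) - R ((2 * M - 1) div 2)"
proof -
  obtain L where L: "M = Suc L" using assms(1) by (cases M) auto
  have "chi4_divisor_sum (2 * M) = chi4_divisor_sum M"
    using chi4_divisor_sum_prime_mult[of 2 M] assms(1) by (simp add: chi4_def)
  moreover have "R (2 * M) = R (2 * L + 1) + real_of_int (chi4_divisor_sum (2 * M))"
    unfolding R_def sum_chi4_divisor_sum[symmetric] L by simp
  moreover have "R M = R L + real_of_int (chi4_divisor_sum M)"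
    unfolding R_def sum_chi4_divisor_sum[symmetric] L by simp
  ultimately show ?thesis by (simp add: L)
qed

text \<open>
Dirichlet's hyperbola method: a pair with product at most \<open>N\<close> has a component at most \<open>m\<close>, and
all pairs with both components at most \<open>m\<close> qualify.
\<close>

lemma hyperbola_method:
  assumes "m * m \<le> N" "N < Suc m * Suc m"
  shows "quotient_sum real N = 2 * (\<Sum>k=1..m. real (N div k)) - real m ^ 2"
proof -
  define P where "P = (SIGMA a:{1..N}. {1..N div a})"
  define A where "A = (SIGMA a:{1..m}. {1..N div a})"
  define B where "B = prod.swap ` A"
  have memP: "(a, b) \<in> P \<longleftrightarrow> 1 \<le> a \<and> 1 \<le> b \<and> a * b \<le> N" for a b
  proof -
    have "a \<le> N" if "1 \<le> b" "a * b \<le> N"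
    proof -
      have "a \<le> a * b" using that by simp
      thus ?thesis using that by linarith
    qed
    thus ?thesis by (auto simp: P_def less_eq_div_iff_mult_less_eq mult.commute)
  qed
  have memA: "(a, b) \<in> A \<longleftrightarrow> 1 \<le> a \<and> a \<le> m \<and> 1 \<le> b \<and> a * b \<le> N" for a b
    by (auto simp: A_def less_eq_div_iff_mult_less_eq mult.commute)
  have memB: "(a, b) \<in> B \<longleftrightarrow> 1 \<le> b \<and> b \<le> m \<and> 1 \<le> a \<and> a * b \<le> N" for a b
  proof -
    have "(a, b) \<in> B \<longleftrightarrow> (b, a) \<in> A" by (force simp: B_def)
    thus ?thesis by (simp add: memA mult.commute)
  qed
  have small: "a \<le> m \<or> b \<le> m" if "a * b \<le> N" for a b
  proof (rule ccontr)
    assume "\<not> ?thesis"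
    hence "Suc m * Suc m \<le> a * b" by (intro mult_le_mono) auto
    thus False using that assms by simp
  qed
  have un: "P = A \<union> B"
  proof (rule Set.set_eqI)
    fix z :: "nat \<times> nat"
    obtain a b where z: "z = (a, b)" by (cases z)
    show "z \<in> P \<longleftrightarrow> z \<in> A \<union> B"
      unfolding z Un_iff memP memA memB using small[of a b] by blast
  qed
  have int: "A \<inter> B = {1..m} \<times> {1..m}"
  proof -
    have "a * b \<le> N" if "a \<le> m" "b \<le> m" for a b
      using mult_le_mono[OF that] assms(1) by simp
    hence "z \<in> A \<inter> B \<longleftrightarrow> z \<in> {1..m} \<times> {1..m}" for z
      by (cases z) (auto simp: memA memB)
    thus ?thesis by blast
  qed
  have "finite A" by (simp add: A_def)
  hence "finite B" by (simp add: B_def)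
  have "card B = card A" unfolding B_def by (rule card_image) auto
  have "card A + card B = card P + card (A \<inter> B)"
    unfolding un by (rule card_Un_Int) fact+
  hence "real (card P) = 2 * real (card A) - real (card (A \<inter> B))"
    using \<open>card B = card A\<close> by linarith
  moreover have "real (card A) = (\<Sum>k=1..m. real (N div k))" by (simp add: A_def)
  moreover have "real (card (A \<inter> B)) = real m ^ 2"
    unfolding int by (simp add: card_cartesian_product power2_eq_square)
  moreover have "real (card P) = quotient_sum real N"
    unfolding P_def by (rule card_hyperbola_points)
  ultimately show ?thesis by simp
qed

lemma harm_minus_ln_bounds:
  assumes "m > 0"
  shows "ln (real m) + euler_mascheroni \<le> harm m" "harm m \<le> ln (real m) + euler_mascheroni + 1 / real m"
proof -
  have "euler_mascheroni \<le> harm m - ln (real m)"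
  proof (rule LIMSEQ_le_const2[OF euler_mascheroni_LIMSEQ])
    show "\<exists>N. \<forall>n\<ge>N. harm n - ln (real n) \<le> harm m - ln (real m)"
      using euler_mascheroni_sequence_decreasing[OF assms] by blast
  qed
  thus "ln (real m) + euler_mascheroni \<le> harm m" by simp
  have "harm m - ln (real (Suc m)) \<le> euler_mascheroni"
    using euler_mascheroni_bounds[of m] assms by (simp add: field_simps)
  moreover have "ln (real (Suc m)) \<le> ln (real m) + 1 / real m"
  proof -
    have "real (Suc m) = real m * (1 + 1 / real m)" using assms by (simp add: field_simps)
    hence "ln (real (Suc m)) = ln (real m) + ln (1 + 1 / real m)"
      using assms by (simp add: ln_mult_pos add_pos_nonneg)
    also have "ln (1 + 1 / real m) \<le> 1 / real m" by (rule ln_add_one_self_le_self) simp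
    finally show ?thesis by simp
  qed
  ultimately show "harm m \<le> ln (real m) + euler_mascheroni + 1 / real m" by simp
qed

text \<open>
The main term in the Dirichlet divisor problem. Its value at \<open>0\<close> is \<open>0\<close>, as \<open>0 * ln 0 = 0\<close>.
\<close>

definition divisor_main :: "real \<Rightarrow> real" where
  "divisor_main x = x * ln x + (2 * euler_mascheroni - 1) * x"

text \<open>
In \<open>2 * (\<Sum>k\<le>m. N div k) - m\<^sup>2\<close> with \<open>m = \<lfloor>\<surd>N\<rfloor>\<close>, dropping the floors costs at most \<open>2 m\<close>, and the
sum becomes \<open>2 N\<close> times a harmonic number, where \<open>2 ln m\<close> and \<open>ln N\<close> differ by at most \<open>2 / m\<close>.
All errors are at most constant multiples of \<open>m\<close>, because \<open>N - m\<^sup>2 \<le> 2 m\<close> and \<open>N / m \<le> m + 2 \<le> 3 m\<close>.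
\<close>

theorem dirichlet_divisor_estimate:
  assumes "N > 0"
  shows "\<bar>quotient_sum real N - divisor_main (real N)\<bar> \<le> 8 * sqrt (real N)"
proof -
  define m where "m = nat \<lfloor>sqrt (real N)\<rfloor>"
  have m_le: "real m \<le> sqrt (real N)" and lt_m: "sqrt (real N) < real (Suc m)"
    unfolding m_def using real_sqrt_ge_zero[of "real N"] by linarith+
  have "real m * real m \<le> sqrt (real N) * sqrt (real N)" using m_le by (intro mult_mono) auto
  hence mm: "m * m \<le> N" by (metis abs_of_nat of_nat_le_iff of_nat_mult real_sqrt_mult_self)
  have "sqrt (real N) * sqrt (real N) < real (Suc m) * real (Suc m)"
    using lt_m by (intro mult_strict_mono) auto
  hence mm': "N < Suc m * Suc m" by (metis abs_of_nat of_nat_less_iff of_nat_mult real_sqrt_mult_self)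
  have m: "m > 0" using mm' assms by (cases m) auto
  define S where "S = (\<Sum>k=1..m. real (N div k))"
  let ?N = "real N" and ?m = "real m" and ?g = "euler_mascheroni :: real"
  have N_hi: "?N \<le> ?m ^ 2 + 2 * ?m"
  proof -
    have "N \<le> m ^ 2 + 2 * m" using mm' by (simp add: power2_eq_square)
    hence "?N \<le> real (m ^ 2 + 2 * m)" by (simp only: of_nat_le_iff)
    thus ?thesis by simp
  qed
  have N_lo: "?m ^ 2 \<le> ?N" using mm by (metis of_nat_le_iff of_nat_power power2_eq_square)
  have Nm: "?N / ?m \<le> 3 * ?m"
  proof -
    have "?m * 1 \<le> ?m * ?m" using m by (intro mult_left_mono) auto
    hence "?N \<le> 3 * ?m * ?m" using N_hi by (simp add: power2_eq_square)
    thus ?thesis using m by (simp add: field_simps)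
  qed
  have harm: "harm m = (\<Sum>k=1..m. 1 / real k)" by (simp add: harm_def inverse_eq_divide)
  have S_hi: "S \<le> ?N * harm m"
    unfolding S_def harm sum_distrib_left
    by (intro sum_mono) (simp add: of_nat_div_le_of_nat)
  have S_lo: "?N * harm m - ?m \<le> S"
  proof -
    have "?N * harm m - ?m = (\<Sum>k=1..m. ?N * (1 / real k) - 1)"
      by (simp add: harm sum_distrib_left sum_subtractf)
    also have "\<dots> \<le> S" unfolding S_def
    proof (intro sum_mono)
      fix k assume "k \<in> {1..m}"
      show "?N * (1 / real k) - 1 \<le> real (N div k)" using floor_correct[of "?N / real k"] by (simp add: floor_divide_of_nat_eq)
    qed
    finally show ?thesis .
  qed
  have ln_lo: "2 * ln ?m \<le> ln ?N"
  proof -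
    have "ln (?m ^ 2) \<le> ln ?N" using N_lo m assms by simp
    thus ?thesis using m by (simp add: ln_realpow)
  qed
  have ln_hi: "ln ?N \<le> 2 * ln ?m + 2 / ?m"
  proof -
    have "?m * (1 + 1 / ?m) = ?m + 1" using m by (simp add: field_simps)
    hence "?N \<le> (?m * (1 + 1 / ?m)) ^ 2" using N_hi by (simp add: power2_eq_square algebra_simps)
    hence "ln ?N \<le> ln ((?m * (1 + 1 / ?m)) ^ 2)"
      using assms m by (subst ln_le_cancel_iff) (auto intro!: zero_less_power mult_pos_pos add_pos_nonneg)
    also have "\<dots> = 2 * (ln ?m + ln (1 + 1 / ?m))"
      using m by (simp add: ln_realpow ln_mult_pos add_pos_nonneg)
    also have "ln (1 + 1 / ?m) \<le> 1 / ?m" by (rule ln_add_one_self_le_self) simp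
    finally show ?thesis by simp
  qed
  have D: "quotient_sum real N = 2 * S - ?m ^ 2"
    unfolding S_def by (rule hyperbola_method[OF mm mm'])
  define Q where "Q = ?N / ?m"
  have Nm': "Q \<le> 3 * ?m" using Nm by (simp add: Q_def)
  define M where "M = ?m ^ 2"
  have N_lo': "M \<le> ?N" and D': "quotient_sum real N = 2 * S - M"
    using N_lo D by (simp_all only: M_def)
  have "quotient_sum real N - divisor_main ?N \<le> 8 * ?m"
  proof -
    have "?N * harm m \<le> ?N * (ln ?m + ?g + 1 / ?m)"
      using harm_minus_ln_bounds(2)[OF m] by (intro mult_left_mono) auto
    moreover have "?N * (2 * ln ?m) \<le> ?N * ln ?N" using ln_lo by (intro mult_left_mono) auto
    ultimately show ?thesis
      using S_hi N_hi Nm unfolding D divisor_main_def by (simp add: algebra_simps)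
  qed
  moreover have "- (8 * ?m) \<le> quotient_sum real N - divisor_main ?N"
  proof -
    have "?N * (ln ?m + ?g) \<le> ?N * harm m"
      using harm_minus_ln_bounds(1)[OF m] by (intro mult_left_mono) auto
    moreover have "?N * ln ?N \<le> 2 * (?N * ln ?m) + 2 * Q"
      using mult_left_mono[OF ln_hi, of ?N] by (simp add: algebra_simps Q_def)
    ultimately show ?thesis
      using S_lo N_lo' Nm' unfolding D' divisor_main_def by (simp add: algebra_simps)
  qed
  ultimately have "\<bar>quotient_sum real N - divisor_main ?N\<bar> \<le> 8 * ?m" by linarith
  thus ?thesis using m_le by linarith
qed

section \<open>The divisor bound\<close>

lemma card_divisors_primepow_mult_le:
  fixes p m :: nat
  assumes "prime p" "m > 0"
  shows "card {d. d dvd p ^ k * m} \<le> (k + 1) * card {d. d dvd m}"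
proof -
  have "{d. d dvd p ^ k * m} \<subseteq> (\<lambda>(i, c). p ^ i * c) ` ({..k} \<times> {d. d dvd m})"
  proof
    fix d assume "d \<in> {d. d dvd p ^ k * m}"
    then obtain b c where bc: "d = b * c" "b dvd p ^ k" "c dvd m"
      using division_decomp[of d "p ^ k" m] by auto
    then obtain i where "i \<le> k" "b = p ^ i"
      using divides_primepow_nat[OF assms(1)] by blast
    thus "d \<in> (\<lambda>(i, c). p ^ i * c) ` ({..k} \<times> {d. d dvd m})"
      using bc by (intro rev_image_eqI[of "(i, c)"]) auto
  qed
  hence "card {d. d dvd p ^ k * m} \<le> card ({..k} \<times> {d. d dvd m})"
    using assms by (intro surj_card_le) auto
  thus ?thesis by (simp add: card_cartesian_product)
qed

text \<open>
The ratio of the number of divisors to \<open>n powr \<epsilon>\<close> is a product over the prime powers \<open>p ^ k\<close> that exactly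
divide \<open>n\<close>, with factors \<open>(k + 1) / (p powr \<epsilon>) ^ k\<close>. These are at most \<open>1\<close> if \<open>p powr \<epsilon> \<ge> 2\<close>,
and at most a constant \<open>B\<close> for each of the finitely many smaller primes.
\<close>

theorem divisor_bound:
  fixes \<epsilon> :: real
  assumes "\<epsilon> > 0"
  obtains C where "C \<ge> 1" "\<And>n. n > 0 \<Longrightarrow> real (card {d. d dvd n}) \<le> C * real n powr \<epsilon>"
proof -
  \<comment> \<open>\<open>B\<close> makes \<open>k + 1 \<le> B * (1 + k \<epsilon> ln 2) \<le> B * 2 powr (k \<epsilon>)\<close>; primes from \<open>P\<close> on have \<open>p powr \<epsilon> \<ge> 2\<close>.\<close>
  define B where "B = max 1 (1 / (\<epsilon> * ln 2))"
  define P where "P = nat \<lceil>2 powr (1 / \<epsilon>)\<rceil>"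
  define s where "s = (\<lambda>n::nat. card {p. prime p \<and> p dvd n \<and> p < P})"
  have B1: "B \<ge> 1" by (simp add: B_def)
  have small: "real k + 1 \<le> B * (real p powr \<epsilon>) ^ k" if "p \<ge> 2" for k p :: nat
  proof -
    have B2: "1 \<le> B * (\<epsilon> * ln 2)"
    proof -
      have "1 = 1 / (\<epsilon> * ln 2) * (\<epsilon> * ln 2)" using assms by simp
      also have "\<dots> \<le> B * (\<epsilon> * ln 2)" using assms by (intro mult_right_mono) (auto simp: B_def)
      finally show ?thesis .
    qed
    have "real k + 1 \<le> B * (real k * (\<epsilon> * ln 2)) + B"
      using mult_left_mono[OF B2, of "real k"] B1 by (simp add: algebra_simps)
    also have "\<dots> = B * (1 + real k * (\<epsilon> * ln 2))" by (simp add: algebra_simps)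
    also have "\<dots> \<le> B * exp (real k * (\<epsilon> * ln 2))"
      using B1 by (intro mult_left_mono exp_ge_add_one_self) auto
    also have "exp (real k * (\<epsilon> * ln 2)) = (2 powr \<epsilon>) ^ k"
      by (simp add: powr_def exp_of_nat_mult)
    also have "B * (2 powr \<epsilon>) ^ k \<le> B * (real p powr \<epsilon>) ^ k"
      using that B1 assms by (intro mult_left_mono power_mono powr_mono2) auto
    finally show ?thesis .
  qed
  have large: "real k + 1 \<le> (real p powr \<epsilon>) ^ k" if "p \<ge> P" for k p :: nat
  proof -
    have "2 powr (1 / \<epsilon>) \<le> real p" using that unfolding P_def by linarith
    hence "(2 powr (1 / \<epsilon>)) powr \<epsilon> \<le> real p powr \<epsilon>" using assms by (intro powr_mono2) auto
    hence "2 \<le> real p powr \<epsilon>" using assms by (simp add: powr_powr)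
    hence "2 ^ k \<le> (real p powr \<epsilon>) ^ k" by (intro power_mono) auto
    moreover have "k + 1 \<le> 2 ^ k" by (induction k) auto
    hence "real (k + 1) \<le> real (2 ^ k)" by (simp only: of_nat_le_iff)
    ultimately show ?thesis by simp
  qed
  have bound: "real (card {d. d dvd n}) \<le> B ^ s n * real n powr \<epsilon>" if "n > 0" for n
    using that
  proof (induction n rule: less_induct)
    case (less n)
    show ?case
    proof (cases "n = 1")
      case True
      have "{d::nat. d dvd 1} = {1}" by auto
      thus ?thesis using B1 by (simp add: True)
    next
      case False
      then obtain p where p: "prime p" "p dvd n" using prime_factor_nat by blast
      have p2: "p \<ge> 2" using p(1) by (rule prime_ge_2_nat)
      define k where "k = multiplicity p n"
      obtain m where m: "n = p ^ k * m" "\<not> p dvd m"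
        using multiplicity_decompose'[of n p] less.prems p unfolding k_def by (metis not_prime_unit not_gr_zero)
      have k0: "k > 0" using m p(2) by (cases k) auto
      have m0: "m > 0" using m less.prems by (cases m) auto
      have "1 < p ^ k" using p2 k0 by (intro one_less_power) auto
      hence mn: "m < n" using m m0 by simp
      have npow: "real n powr \<epsilon> = (real p powr \<epsilon>) ^ k * real m powr \<epsilon>"
        using p2 by (simp add: m(1) powr_mult powr_realpow[symmetric] powr_powr mult.commute)
      have "real (card {d. d dvd n}) \<le> real ((k + 1) * card {d. d dvd m})"
        unfolding m(1) using card_divisors_primepow_mult_le[OF p(1) m0, of k] by (simp only: of_nat_le_iff)
      also have "\<dots> = (real k + 1) * real (card {d. d dvd m})"
        by (simp only: of_nat_mult of_nat_add of_nat_1)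
      also have "\<dots> \<le> (real k + 1) * (B ^ s m * real m powr \<epsilon>)"
        using less.IH[OF mn m0] by (intro mult_left_mono) auto
      also have "\<dots> = B ^ s m * (real k + 1) * real m powr \<epsilon>" by simp
      also have "\<dots> \<le> B ^ s n * (real p powr \<epsilon>) ^ k * real m powr \<epsilon>"
      proof (rule mult_right_mono)
        have sub: "{q. prime q \<and> q dvd m \<and> q < P} \<subseteq> {q. prime q \<and> q dvd n \<and> q < P}"
          by (auto simp: m(1))
        show "B ^ s m * (real k + 1) \<le> B ^ s n * (real p powr \<epsilon>) ^ k"
        proof (cases "p < P")
          case True
          have "{q. prime q \<and> q dvd m \<and> q < P} \<subset> {q. prime q \<and> q dvd n \<and> q < P}"
            using sub p m(2) True by blast
          hence "s m < s n" unfolding s_def by (intro psubset_card_mono) auto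
          hence "B ^ (s m + 1) \<le> B ^ s n" using B1 by (intro power_increasing) auto
          have "B ^ s m * (real k + 1) \<le> B ^ s m * (B * (real p powr \<epsilon>) ^ k)"
            using small[OF p2] B1 by (intro mult_left_mono) auto
          also have "\<dots> = B ^ (s m + 1) * (real p powr \<epsilon>) ^ k" by simp
          also have "\<dots> \<le> B ^ s n * (real p powr \<epsilon>) ^ k"
            by (rule mult_right_mono) (fact, simp)
          finally show ?thesis .
        next
          case False
          have "s m \<le> s n" unfolding s_def using sub by (intro card_mono) auto
          hence "B ^ s m \<le> B ^ s n" using B1 by (intro power_increasing) auto
          thus ?thesis using large[of p k] False B1 by (intro mult_mono) auto
        qed
      qed auto
      finally show ?thesis by (simp add: npow mult.assoc)
    qed
  qed
  show ?thesis
  proof (rule that[of "B ^ P"])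
    show "B ^ P \<ge> 1" using B1 by (rule one_le_power)
    fix n :: nat assume n: "n > 0"
    have "s n \<le> card {..<P}" unfolding s_def by (intro card_mono) auto
    hence "B ^ s n \<le> B ^ P" using B1 by (intro power_increasing) auto
    hence "B ^ s n * real n powr \<epsilon> \<le> B ^ P * real n powr \<epsilon>" by (intro mult_right_mono) auto
    thus "real (card {d. d dvd n}) \<le> B ^ P * real n powr \<epsilon>" using bound[OF n] by linarith
  qed
qed

section \<open>Sums of fractional parts as lattice point counts\<close>

lemma fib_Suc_ge_power: "(3 / 2) ^ r \<le> 2 * real (fib (r + 1))"
proof (induction r rule: fib.induct)
  case (3 r)
  have "(3 / 2 :: real) ^ Suc (Suc r) \<le> (3 / 2) ^ r + (3 / 2) ^ Suc r" by simp
  also have "\<dots> \<le> 2 * real (fib (Suc (Suc r) + 1))" using 3 by simp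
  finally show ?case .
qed auto

lemma sum_inverse_fib_le: "(\<Sum>r\<le>n. 1 / real (fib (r + 1))) \<le> 6"
proof -
  have "(\<Sum>r\<le>n. 1 / real (fib (r + 1))) \<le> (\<Sum>r\<le>n. 2 * (2 / 3) ^ r)"
  proof (rule sum_mono)
    fix r
    have "0 < real (fib (r + 1))" by (simp add: fib_neq_0_nat)
    thus "1 / real (fib (r + 1)) \<le> 2 * (2 / 3) ^ r"
      using fib_Suc_ge_power[of r] by (simp add: field_simps)
  qed
  also have "(\<Sum>r\<le>n. 2 * (2 / 3 :: real) ^ r) = 6 - 4 * (2 / 3) ^ n" by (induction n) auto
  also have "\<dots> \<le> 6" by simp
  finally show ?thesis .
qed

text \<open>
Grouping the terms by the value of \<open>g\<close> leaves a convergent series times the size of the largest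
fibre.
\<close>

lemma sum_inverse_fib_fibres_le:
  assumes "\<And>k. k \<in> {1..n} \<Longrightarrow> g k \<le> n"
    and "\<And>r. r \<le> n \<Longrightarrow> real (card {k \<in> {1..n}. g k = r}) \<le> T" and "T \<ge> 0"
  shows "(\<Sum>k=1..n. 1 / real (fib (g k + 1))) \<le> 6 * T"
proof -
  have "(\<Sum>k=1..n. 1 / real (fib (g k + 1))) =
      (\<Sum>r\<le>n. \<Sum>k \<in> {k \<in> {1..n}. g k = r}. 1 / real (fib (g k + 1)))"
    by (rule sum.group[symmetric]) (use assms(1) in auto)
  also have "\<dots> = (\<Sum>r\<le>n. real (card {k \<in> {1..n}. g k = r}) * (1 / real (fib (r + 1))))"
    by (intro sum.cong refl) simp
  also have "\<dots> \<le> (\<Sum>r\<le>n. T * (1 / real (fib (r + 1))))"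
    using assms(2) by (intro sum_mono mult_right_mono) auto
  also have "\<dots> = T * (\<Sum>r\<le>n. 1 / real (fib (r + 1)))" by (simp add: sum_distrib_left)
  also have "\<dots> \<le> T * 6" using assms(3) sum_inverse_fib_le by (intro mult_left_mono) auto
  finally show ?thesis by simp
qed

text \<open>
By \<open>frac_fib_quotient\<close> the error is a sum over \<open>k\<close> of reciprocal Fibonacci numbers at the indices
\<open>n mod k + 1\<close> and \<open>k - n mod k + 1\<close>. If \<open>n mod k = r\<close>, then \<open>k\<close> divides \<open>n - r\<close>; if
\<open>k - n mod k = r\<close>, then \<open>k\<close> divides \<open>n + r\<close>. So each index occurs at most as often as there are
divisors of a number up to \<open>2 n\<close>.
\<close>

theorem fib_frac_sum_wraps_count:
  fixes \<epsilon> :: real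
  assumes "\<epsilon> > 0"
  obtains C where "\<And>n. n > 0 \<Longrightarrow>
    \<bar>fib_frac_sum n - (\<Sum>k=1..n. of_bool (wraps_below n k))\<bar> \<le> C * real n powr \<epsilon>"
proof -
  obtain C where C: "C \<ge> 1" "\<And>n. n > 0 \<Longrightarrow> real (card {d. d dvd n}) \<le> C * real n powr \<epsilon>"
    using divisor_bound[OF assms] by blast
  \<comment> \<open>The factor allows for divisors of numbers up to \<open>2 n\<close>.\<close>
  define K where "K = C * 2 powr \<epsilon>"
  have tau: "real (card A) \<le> K * real n powr \<epsilon>"
    if "A \<subseteq> {d. d dvd l}" "0 < l" "l \<le> 2 * n" for A l n
  proof -
    have "real (card A) \<le> real (card {d. d dvd l})"
      using that by (intro of_nat_mono card_mono) auto
    also have "\<dots> \<le> C * real l powr \<epsilon>" using C(2) that by blast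
    also have "\<dots> \<le> C * real (2 * n) powr \<epsilon>"
      using C(1) that assms by (intro mult_left_mono powr_mono2) auto
    also have "\<dots> = K * real n powr \<epsilon>" by (simp add: K_def powr_mult)
    finally show ?thesis .
  qed
  have "\<bar>fib_frac_sum n - (\<Sum>k=1..n. of_bool (wraps_below n k))\<bar> \<le> (12 * K) * real n powr \<epsilon>"
    if n: "n > 0" for n
  proof -
    let ?T = "K * real n powr \<epsilon>"
    have T0: "?T \<ge> 0" using C(1) by (simp add: K_def)
    have "\<bar>fib_frac_sum n - (\<Sum>k=1..n. of_bool (wraps_below n k))\<bar> =
        \<bar>\<Sum>k=1..n. frac (real (fib n) / real (fib k)) - of_bool (wraps_below n k)\<bar>"
      by (simp add: fib_frac_sum_def sum_subtractf)
    also have "\<dots> \<le> (\<Sum>k=1..n. \<bar>frac (real (fib n) / real (fib k)) - of_bool (wraps_below n k)\<bar>)"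
      by (rule sum_abs)
    also have "\<dots> \<le> (\<Sum>k=1..n. 1 / real (fib (n mod k + 1)) + 1 / real (fib (k - n mod k + 1)))"
      by (intro sum_mono frac_fib_quotient) auto
    also have "\<dots> = (\<Sum>k=1..n. 1 / real (fib (n mod k + 1))) +
        (\<Sum>k=1..n. 1 / real (fib (k - n mod k + 1)))" by (rule sum.distrib)
    also have "\<dots> \<le> 6 * ?T + 6 * ?T"
    proof (intro add_mono sum_inverse_fib_fibres_le T0)
      fix k assume "k \<in> {1..n}"
      show "n mod k \<le> n" by simp
      show "k - n mod k \<le> n" using \<open>k \<in> {1..n}\<close> by auto
    next
      fix r assume "r \<le> n"
      show "real (card {k \<in> {1..n}. n mod k = r}) \<le> ?T"
      proof (cases "r = n")
        case True
        have "n mod k < n" if "k \<in> {1..n}" for k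
          using that by (meson atLeastAtMost_iff le_trans mod_less_divisor not_less less_le_trans zero_less_one)
        hence "{k \<in> {1..n}. n mod k = r} = {}" using True by fastforce
        thus ?thesis using T0 by (simp only: card.empty of_nat_0)
      next
        case False
        thus ?thesis using \<open>r \<le> n\<close>
          by (intro tau[of _ "n - r"]) (auto simp: minus_mod_eq_mult_div)
      qed
      have "k dvd n + r" if "k \<in> {1..n}" "k - n mod k = r" for k
      proof -
        have "n mod k < k" using that by simp
        hence "n + r = (n - n mod k) + k" using that mod_less_eq_dividend[of n k] by linarith
        thus ?thesis by (simp add: minus_mod_eq_mult_div)
      qed
      thus "real (card {k \<in> {1..n}. k - n mod k = r}) \<le> ?T"
        using \<open>r \<le> n\<close> n by (intro tau[of _ "n + r"]) auto
    qed
    finally show ?thesis by simp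
  qed
  thus ?thesis by (rule that)
qed

text \<open>
For odd \<open>n\<close> the signs that are negative are those with \<open>k\<close> odd and \<open>n div k\<close> congruent to \<open>1\<close>
or \<open>2\<close> modulo \<open>4\<close>, which is exactly where the partial sums of \<open>chi4\<close> equal \<open>1\<close>. Restricting to odd \<open>k\<close> means
subtracting the terms with even \<open>k\<close>, and these form the same sum at \<open>n div 2\<close>.
\<close>

theorem fib_frac_sum_odd:
  fixes \<epsilon> :: real
  assumes "\<epsilon> > 0"
  obtains C where "\<And>n. odd n \<Longrightarrow>
    \<bar>fib_frac_sum n - (quotient_sum chi4_partial_sum n - quotient_sum chi4_partial_sum (n div 2))\<bar>
      \<le> C * real n powr \<epsilon>"
proof -
  obtain C where C: "\<And>n. n > 0 \<Longrightarrow>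
    \<bar>fib_frac_sum n - (\<Sum>k=1..n. of_bool (wraps_below n k))\<bar> \<le> C * real n powr \<epsilon>"
    using fib_frac_sum_wraps_count[OF assms] by blast
  have count: "(\<Sum>k=1..n. of_bool (wraps_below n k)) =
      quotient_sum chi4_partial_sum n - quotient_sum chi4_partial_sum (n div 2)" if "odd n" for n
  proof -
    have "(\<Sum>k=1..n. of_bool (wraps_below n k)) = (\<Sum>k=1..n. chi4_partial_sum (n div k)
        - (if even k then chi4_partial_sum (n div k) else 0))"
      using that by (intro sum.cong refl) (simp add: wraps_below_iff chi4_partial_sum_def)
    also have "\<dots> = quotient_sum chi4_partial_sum n - quotient_sum chi4_partial_sum (n div 2)"
      unfolding sum_subtractf quotient_sum_even by (simp add: quotient_sum_def)
    finally show ?thesis .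
  qed
  show ?thesis
  proof (rule that[of C])
    fix n :: nat assume n: "odd n"
    from C[OF odd_pos[OF n], unfolded count[OF n]]
    show "\<bar>fib_frac_sum n - (quotient_sum chi4_partial_sum n - quotient_sum chi4_partial_sum (n div 2))\<bar>
      \<le> C * real n powr \<epsilon>" .
  qed
qed

text \<open>
For even \<open>n\<close> the indicator of a negative sign is a linear combination of the numbers
\<open>\<lfloor>n / (c k)\<rfloor>\<close> with \<open>c \<in> {1, 2, 4}\<close>, with different coefficients for odd and even \<open>k\<close>. Summing over
\<open>k\<close> leaves the lattice point counts under the hyperbola at \<open>n / 2\<close>, \<open>n / 4\<close> and \<open>n / 8\<close>.
\<close>

theorem fib_frac_sum_even:
  fixes \<epsilon> :: real
  assumes "\<epsilon> > 0"
  defines "D \<equiv> quotient_sum real"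
  obtains C where "\<And>n. even n \<Longrightarrow> n > 0 \<Longrightarrow>
    \<bar>fib_frac_sum n - (2 * D (n div 2) - 5 * D (n div 4) + 2 * D (n div 8))\<bar>
      \<le> C * real n powr \<epsilon>"
proof -
  obtain C where C: "\<And>n. n > 0 \<Longrightarrow>
    \<bar>fib_frac_sum n - (\<Sum>k=1..n. of_bool (wraps_below n k))\<bar> \<le> C * real n powr \<epsilon>"
    using fib_frac_sum_wraps_count[OF assms(1)] by blast
  have count: "(\<Sum>k=1..n. of_bool (wraps_below n k)) =
      2 * D (n div 2) - 5 * D (n div 4) + 2 * D (n div 8)" if "even n" for n
  proof -
    define g where "g = (\<lambda>q::nat. 1 * real (q div 2) + (-2) * real (q div 4))"
    define h where "h = (\<lambda>q::nat. 1 * real (q div 1) + (-2) * real (q div 2))"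
    have g: "of_bool (q mod 4 \<in> {2, 3}) = g q" for q
    proof -
      have "q div 2 = 2 * (q div 4) + of_bool (q mod 4 \<in> {2, 3})" by (simp add: of_bool_def) presburger
      thus ?thesis by (simp add: g_def)
    qed
    have h: "of_bool (odd q) = h q" for q
    proof -
      have "q = 2 * (q div 2) + of_bool (odd q)" by (simp add: of_bool_def)
      hence "real q = 2 * real (q div 2) + of_bool (odd q)"
        by (metis of_nat_add of_nat_mult of_nat_numeral of_nat_of_bool)
      thus ?thesis by (simp add: h_def)
    qed
    have g_sum: "quotient_sum g N = D (N div 2) - 2 * D (N div 4)" for N
      unfolding g_def quotient_sum_linear D_def by (simp add: quotient_sum_div)
    have h_sum: "quotient_sum h N = D N - 2 * D (N div 2)" for N
      unfolding h_def quotient_sum_linear D_def by (simp add: quotient_sum_div)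
    have "(\<Sum>k=1..n. of_bool (wraps_below n k)) = (\<Sum>k=1..n. g (n div k)
        - (if even k then g (n div k) else 0) + (if even k then h (n div k) else 0))"
      using that by (intro sum.cong refl) (simp add: wraps_below_iff flip: g h)
    also have "\<dots> = quotient_sum g n - quotient_sum g (n div 2) + quotient_sum h (n div 2)"
      unfolding sum.distrib sum_subtractf quotient_sum_even by (simp add: quotient_sum_def)
    also have "\<dots> = 2 * D (n div 2) - 5 * D (n div 4) + 2 * D (n div 8)"
      unfolding g_sum h_sum by (simp flip: div_mult2_eq)
    finally show ?thesis .
  qed
  show ?thesis
  proof (rule that[of C])
    fix n :: nat assume n: "even n" "n > 0"
    from C[OF n(2), unfolded count[OF n(1)]]
    show "\<bar>fib_frac_sum n - (2 * D (n div 2) - 5 * D (n div 4) + 2 * D (n div 8))\<bar>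
      \<le> C * real n powr \<epsilon>" .
  qed
qed

section \<open>Recursions along halving and doubling\<close>

text \<open>
Iterating down to \<open>0\<close> adds the errors \<open>C (N / 2 ^ i) powr s\<close>, which form a geometric series.
\<close>

lemma halving_recursion_bound:
  fixes e :: "nat \<Rightarrow> real"
  assumes "0 \<le> \<mu>" "\<mu> \<le> 1" "s > 0" "e 0 = 0"
    and rec: "\<And>N. N > 0 \<Longrightarrow> \<bar>e N - \<mu> * e (N div 2)\<bar> \<le> C * real N powr s"
  shows "\<bar>e N\<bar> \<le> C / (1 - 2 powr (- s)) * real N powr s"
proof -
  define t where "t = (2::real) powr (- s)"
  define K where "K = C / (1 - t)"
  have t: "0 < t" "t < 1" using assms(3) by (simp_all add: t_def powr_less_one)
  have C: "C \<ge> 0" using rec[of 1] by simp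
  have K: "K \<ge> 0" "C + K * t = K" using t C by (simp_all add: K_def field_simps)
  have "\<bar>e N\<bar> \<le> K * real N powr s" for N
  proof (induction N rule: less_induct)
    case (less N)
    show ?case
    proof (cases "N = 0")
      case True
      thus ?thesis using assms(4) by simp
    next
      case False
      have "real (N div 2) powr s \<le> (real N / 2) powr s"
        using assms(3) of_nat_div_le_of_nat[of N 2] by (intro powr_mono2) auto
      also have "\<dots> = t * real N powr s"
        by (simp add: t_def powr_divide powr_minus_divide)
      finally have half: "real (N div 2) powr s \<le> t * real N powr s" .
      have "\<bar>e N\<bar> \<le> \<bar>e N - \<mu> * e (N div 2)\<bar> + \<bar>\<mu> * e (N div 2)\<bar>" by linarith
      also have "\<bar>\<mu> * e (N div 2)\<bar> \<le> 1 * \<bar>e (N div 2)\<bar>"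
        unfolding abs_mult using assms(1,2) by (intro mult_right_mono) auto
      also have "\<bar>e (N div 2)\<bar> \<le> K * real (N div 2) powr s"
        using False by (intro less.IH) auto
      also have "\<dots> \<le> K * (t * real N powr s)" using half K(1) by (rule mult_left_mono)
      also have "\<bar>e N - \<mu> * e (N div 2)\<bar> \<le> C * real N powr s" using False by (intro rec) auto
      finally have "\<bar>e N\<bar> \<le> (C + K * t) * real N powr s" by (simp add: algebra_simps)
      thus ?thesis by (simp only: K(2))
    qed
  qed
  thus ?thesis by (simp add: K_def t_def)
qed

text \<open>
The recursion alone would allow linear growth of \<open>U\<close>, so it has to be iterated upwards:
\<open>U N\<close> is \<open>U (2 ^ i * N) / 2 ^ i\<close> up to a geometric series of errors that converges as \<open>s < 1\<close>,
and the a priori bound makes the first term tend to \<open>0\<close>.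
\<close>

lemma doubling_recursion_bound:
  fixes U :: "nat \<Rightarrow> real"
  assumes "s < 1"
    and sqrt_bound: "\<And>N. N > 0 \<Longrightarrow> \<bar>U N\<bar> \<le> B * sqrt (real N)"
    and rec: "\<And>N. N > 0 \<Longrightarrow> \<bar>U (2 * N) - 2 * U N\<bar> \<le> C * real N powr s"
    and "N > 0"
  shows "\<bar>U N\<bar> \<le> C / (2 - 2 powr s) * real N powr s"
proof -
  define K where "K = C / (2 - 2 powr s)"
  \<comment> \<open>This \<open>K\<close> absorbs the error of a step, so that \<open>V\<close> satisfies an inequality without error term.\<close>
  define V where "V = (\<lambda>N. \<bar>U N\<bar> - K * real N powr s)"
  have C: "C \<ge> 0" using order_trans[OF abs_ge_zero rec[of 1]] by simp
  have t: "(2::real) powr s < 2" using assms(1) powr_less_mono[of s 1 "2::real"] by simp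
  have K: "K \<ge> 0" "C = K * (2 - 2 powr s)" using t C by (simp_all add: K_def)
  have step: "V M \<le> V (2 * M) / 2" if "M > 0" for M
  proof -
    have "2 * \<bar>U M\<bar> \<le> \<bar>U (2 * M)\<bar> + C * real M powr s" using rec[OF that] by linarith
    moreover have "real (2 * M) powr s = 2 powr s * real M powr s" by (simp add: powr_mult)
    ultimately show ?thesis unfolding V_def by (simp add: K(2) algebra_simps)
  qed
  have iter: "V N \<le> V (2 ^ i * N) / 2 ^ i" for i
  proof (induction i)
    case (Suc i)
    have "V (2 ^ i * N) \<le> V (2 * (2 ^ i * N)) / 2" using assms(4) by (intro step) auto
    hence "V (2 ^ i * N) / 2 ^ i \<le> V (2 * (2 ^ i * N)) / 2 / 2 ^ i" by (intro divide_right_mono) auto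
    with Suc.IH show ?case by (simp add: mult_ac)
  qed simp
  have "V N \<le> B * sqrt (real N) * (1 / sqrt 2) ^ i" for i
  proof -
    have "V (2 ^ i * N) \<le> \<bar>U (2 ^ i * N)\<bar>" using K(1) by (simp add: V_def)
    also have "\<dots> \<le> B * sqrt (real (2 ^ i * N))" using assms(4) by (intro sqrt_bound) auto
    also have "\<dots> = B * sqrt (real N) * sqrt 2 ^ i" by (simp add: real_sqrt_mult real_sqrt_power)
    finally have "V N \<le> B * sqrt (real N) * sqrt 2 ^ i / 2 ^ i"
      using iter[of i] by (smt (verit) divide_right_mono zero_le_power)
    also have "(2::real) ^ i = sqrt 2 ^ i * sqrt 2 ^ i" by (simp flip: power_mult_distrib)
    finally show ?thesis by (simp add: power_divide)
  qed
  moreover have "(\<lambda>i. B * sqrt (real N) * (1 / sqrt 2) ^ i) \<longlonglongrightarrow> B * sqrt (real N) * 0"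
    by (intro tendsto_mult tendsto_const LIMSEQ_realpow_zero) auto
  ultimately have "V N \<le> B * sqrt (real N) * 0"
    by (intro LIMSEQ_le_const) auto
  thus ?thesis by (simp add: V_def K_def)
qed

lemma divisor_main_floor:
  assumes "x > 0"
  shows "\<bar>divisor_main x - divisor_main (real (nat \<lfloor>x\<rfloor>))\<bar>
     \<le> \<bar>ln x\<bar> + 1 + \<bar>2 * euler_mascheroni - 1\<bar>"
proof -
  define a where "a = real (nat \<lfloor>x\<rfloor>)"
  let ?c = "2 * euler_mascheroni - 1 :: real"
  have a: "0 \<le> a" "a \<le> x" "x - a < 1" using assms unfolding a_def by linarith+
  have lin: "\<bar>?c * (x - a)\<bar> \<le> \<bar>?c\<bar> * 1"
    unfolding abs_mult using a by (intro mult_left_mono) auto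
  have frac_ln: "\<bar>(x - a) * ln x\<bar> \<le> 1 * \<bar>ln x\<bar>"
    unfolding abs_mult using a by (intro mult_right_mono) auto
  have ln_diff: "\<bar>a * (ln x - ln a)\<bar> \<le> 1"
  proof (cases "a = 0")
    case False
    hence "a > 0" using a by simp
    moreover have "1 + (x - a) / a = x / a" using False by (simp add: field_simps)
    ultimately have "ln x - ln a = ln (1 + (x - a) / a)" using assms by (simp add: ln_div)
    also have "\<dots> \<le> (x - a) / a" using a False by (intro ln_add_one_self_le_self) simp
    finally have "a * (ln x - ln a) \<le> a * ((x - a) / a)" using a by (intro mult_left_mono) auto
    moreover have "0 \<le> a * (ln x - ln a)" using a False assms by (intro mult_nonneg_nonneg) auto
    ultimately show ?thesis using a False by simp
  qed simp
  have "divisor_main x - divisor_main a = (x - a) * ln x + a * (ln x - ln a) + ?c * (x - a)"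
    by (simp add: divisor_main_def algebra_simps)
  moreover have "\<bar>p + q + r\<bar> \<le> P + Q + R" if "\<bar>p\<bar> \<le> P" "\<bar>q\<bar> \<le> Q" "\<bar>r\<bar> \<le> R"
    for p q r P Q R :: real using that by linarith
  from this[OF frac_ln ln_diff lin] have
    "\<bar>(x - a) * ln x + a * (ln x - ln a) + ?c * (x - a)\<bar> \<le> \<bar>ln x\<bar> + 1 + \<bar>?c\<bar>"
    by (simp only: mult_1 mult_1_right)
  ultimately show ?thesis by (simp only: a_def)
qed

section \<open>Transfer to the circle and divisor problems\<close>

text \<open>
Let \<open>R\<close> be the summatory function of the divisor sums of \<open>chi4\<close>. The hypothesis controls
\<open>R N - R (N div 2)\<close> for odd \<open>N\<close>, hence for all \<open>N\<close>. The halving recursion yields \<open>R\<close>, which is a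
quarter of the number of lattice points in the disc other than the origin.
\<close>

theorem circle_error_bound:
  fixes s :: real
  assumes "s > 0"
    and bound: "\<And>n. n \<ge> 1 \<Longrightarrow> odd n \<Longrightarrow> \<bar>fib_frac_sum n - pi / 8 * real n\<bar> \<le> C0 * real n powr s"
  obtains C where "\<And>x. x \<ge> 1 \<Longrightarrow> \<bar>Delta_C x\<bar> \<le> C * x powr s"
proof -
  let ?R = "quotient_sum chi4_partial_sum"
  obtain C1 where C1: "\<And>n. odd n \<Longrightarrow>
      \<bar>fib_frac_sum n - (?R n - ?R (n div 2))\<bar> \<le> C1 * real n powr s"
    using fib_frac_sum_odd[OF assms(1)] by blast
  define C where "C = C0 + C1"
  have odd_bound: "\<bar>?R n - ?R (n div 2) - pi / 8 * real n\<bar> \<le> C * real n powr s" if "odd n" for n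
    using bound[OF _ that] C1[OF that] odd_pos[OF that] by (simp add: C_def algebra_simps)
  have C: "C \<ge> 0" using order_trans[OF abs_ge_zero odd_bound[of 1]] by simp
  have one_le: "1 \<le> real N powr s" if "N > 0" for N
    using that assms(1) by (simp add: ge_one_powr_ge_zero)
  have all_bound: "\<bar>?R N - ?R (N div 2) - pi / 8 * real N\<bar> \<le> (C + pi / 8) * real N powr s"
    if N: "N > 0" for N
  proof (cases "odd N")
    case True
    have "C * real N powr s \<le> (C + pi / 8) * real N powr s" by (intro mult_right_mono) auto
    thus ?thesis using odd_bound[OF True] by linarith
  next
    case False
    then obtain M where M: "N = 2 * M" by (auto elim: evenE)
    have "\<bar>?R (N - 1) - ?R ((N - 1) div 2) - pi / 8 * real (N - 1)\<bar> \<le> C * real (N - 1) powr s"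
      using False N by (intro odd_bound) auto
    also have "\<dots> \<le> C * real N powr s" using C assms(1) by (intro mult_left_mono powr_mono2) auto
    also have "?R (N - 1) - ?R ((N - 1) div 2) = ?R N - ?R (N div 2)"
      using quotient_sum_chi4_diff_even[of M] N by (simp add: M)
    finally have "\<bar>?R N - ?R (N div 2) - pi / 8 * (real N - 1)\<bar> \<le> C * real N powr s"
      using N by (simp add: of_nat_diff)
    moreover have "pi / 8 * (real N - 1) = pi / 8 * real N - pi / 8 * 1" by (rule right_diff_distrib)
    ultimately have "\<bar>?R N - ?R (N div 2) - pi / 8 * real N\<bar> \<le> C * real N powr s + pi / 8 * 1"
      using pi_ge_zero by linarith
    also have "\<dots> \<le> C * real N powr s + pi / 8 * real N powr s"
      using one_le[OF N] by (intro add_left_mono mult_left_mono) auto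
    finally show ?thesis by (simp add: algebra_simps)
  qed
  define e where "e = (\<lambda>N. ?R N - pi / 4 * real N)"
  define K where "K = (C + pi / 4) / (1 - 2 powr (- s))"
  have e_bound: "\<bar>e N\<bar> \<le> K * real N powr s" for N
    unfolding K_def
  proof (rule halving_recursion_bound[where \<mu> = 1])
    fix N :: nat assume N: "N > 0"
    have "\<bar>real N / 2 - real (N div 2)\<bar> \<le> 1 / 2"
      by (cases "even N") (auto elim!: evenE oddE)
    hence "pi / 4 * \<bar>real N / 2 - real (N div 2)\<bar> \<le> pi / 4 * (1 / 2)" by (intro mult_left_mono) auto
    also have "\<dots> \<le> pi / 8 * real N powr s"
      using mult_left_mono[OF one_le[OF N], of "pi / 8"] by simp
    finally have "\<bar>pi / 4 * (real N / 2 - real (N div 2))\<bar> \<le> pi / 8 * real N powr s"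
      by (simp add: abs_mult)
    moreover have "e N - 1 * e (N div 2) = (?R N - ?R (N div 2) - pi / 8 * real N)
        - pi / 4 * (real N / 2 - real (N div 2))"
      by (simp add: e_def algebra_simps)
    ultimately have "\<bar>e N - 1 * e (N div 2)\<bar> \<le> (C + pi / 8) * real N powr s + pi / 8 * real N powr s"
      using all_bound[OF N] by linarith
    thus "\<bar>e N - 1 * e (N div 2)\<bar> \<le> (C + pi / 4) * real N powr s" by (simp add: algebra_simps)
  qed (use assms(1) in \<open>auto simp: e_def quotient_sum_def\<close>)
  have K: "K \<ge> 0" using e_bound[of 1] by simp
  show ?thesis
  proof (rule that[of "4 * K + 1 + pi"])
    fix x :: real assume x: "x \<ge> 1"
    define N where "N = nat \<lfloor>x\<rfloor>"
    have N: "real N \<le> x" "x - real N \<le> 1" unfolding N_def using x by linarith+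
    have "Delta_C x = 4 * e N + (1 - pi * (x - real N))"
      using x by (simp add: Delta_C_def N_C_eq_quotient_sum e_def N_def algebra_simps)
    moreover have "\<bar>e N\<bar> \<le> K * x powr s"
    proof -
      have "K * real N powr s \<le> K * x powr s"
        using N K assms(1) by (intro mult_left_mono powr_mono2) auto
      thus ?thesis using e_bound[of N] by linarith
    qed
    moreover have "\<bar>1 - pi * (x - real N)\<bar> \<le> (1 + pi) * x powr s"
    proof -
      define z where "z = pi * (x - real N)"
      have "0 \<le> z" "z \<le> pi * 1"
        unfolding z_def using N by (auto intro!: mult_left_mono)
      hence "\<bar>1 - z\<bar> \<le> (1 + pi) * 1" by simp
      also have "\<dots> \<le> (1 + pi) * x powr s"
        using x assms(1) by (intro mult_left_mono ge_one_powr_ge_zero) (auto simp: add_nonneg_nonneg)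
      finally show ?thesis unfolding z_def .
    qed
    ultimately show "\<bar>Delta_C x\<bar> \<le> (4 * K + 1 + pi) * x powr s" by (simp add: algebra_simps)
  qed
qed

text \<open>
Let \<open>E\<close> be the error term of the divisor problem at integers and let \<open>S\<close> be the operator that
replaces \<open>E(N)\<close> by \<open>E(N/2)\<close>. Since the main terms account for \<open>3 ln 2 / 4\<close>, the hypothesis controls \<open>2 - 5 S + 2 S\<^sup>2 = (1 - 2 S) (2 - S)\<close> applied to \<open>E\<close>. The factor \<open>1 - 2 S\<close> is
inverted upwards, with Dirichlet's bound \<open>O(\<surd>N)\<close> excluding linear growth, and the
factor \<open>2 - S\<close> downwards.
\<close>

theorem hyperbola_error_bound:
  fixes s :: real
  assumes "0 < s" "s < 1"
    and bound: "\<And>n. n \<ge> 1 \<Longrightarrow> even n \<Longrightarrow>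
      \<bar>fib_frac_sum n - 3 * ln 2 / 4 * real n\<bar> \<le> C0 * real n powr s"
  obtains C where "\<And>x. x \<ge> 1 \<Longrightarrow> \<bar>Delta_H x\<bar> \<le> C * x powr s"
proof -
  let ?D = "quotient_sum real" and ?c = "\<bar>2 * euler_mascheroni - 1 :: real\<bar>"
  obtain C1 where C1: "\<And>n. even n \<Longrightarrow> n > 0 \<Longrightarrow>
      \<bar>fib_frac_sum n - (2 * ?D (n div 2) - 5 * ?D (n div 4) + 2 * ?D (n div 8))\<bar>
        \<le> C1 * real n powr s"
    using fib_frac_sum_even[OF assms(1)] by blast
  define E where "E = (\<lambda>N. ?D N - divisor_main (real N))"
  have E0: "E 0 = 0" by (simp add: E_def quotient_sum_def divisor_main_def)
  define U where "U = (\<lambda>N. 2 * E N - E (N div 2))"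
  have sqrt_bound: "\<bar>E N\<bar> \<le> 8 * sqrt (real N)" for N
    using dirichlet_divisor_estimate[of N] E0 by (cases "N = 0") (auto simp: E_def)
  have one_le: "1 \<le> x powr s" if "x \<ge> 1" for x
    using that assms(1) by (simp add: ge_one_powr_ge_zero)
  have ln_le: "ln x \<le> x powr s / s" if "x \<ge> 1" for x :: real
    using that assms(1) by (rule ln_powr_bound)
  define B where "B = 2 * (1 / s + ln 2 + 1 + ?c)"
  define C2 where "C2 = (C0 + C1) * 4 powr s + B"
  have U_rec: "\<bar>U (2 * N) - 2 * U N\<bar> \<le> C2 * real N powr s" if N: "N > 0" for N
  proof -
    let ?N = "real N"
    \<comment> \<open>The argument \<open>4 N\<close> makes the divisions by \<open>2\<close> and \<open>4\<close> exact, so only \<open>N div 2\<close> rounds.\<close>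
    have "\<bar>fib_frac_sum (4 * N) - 3 * ln 2 / 4 * real (4 * N)\<bar> \<le> C0 * real (4 * N) powr s"
      using N by (intro bound) auto
    moreover have "\<bar>fib_frac_sum (4 * N) - (2 * ?D (2 * N) - 5 * ?D N + 2 * ?D (N div 2))\<bar>
        \<le> C1 * real (4 * N) powr s"
      using C1[of "4 * N"] N by (simp add: div_mult2_eq[of "4 * N" 4 2, simplified])
    moreover have "real (4 * N) powr s = 4 powr s * ?N powr s" by (simp add: powr_mult)
    ultimately have D_bound: "\<bar>2 * ?D (2 * N) - 5 * ?D N + 2 * ?D (N div 2) - 3 * ln 2 * ?N\<bar>
        \<le> (C0 + C1) * 4 powr s * ?N powr s"
      by (simp add: algebra_simps)
    have main: "2 * divisor_main (real (2 * N)) - 5 * divisor_main ?N + 2 * divisor_main (?N / 2) =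
        3 * ln 2 * ?N"
      using N by (simp add: divisor_main_def ln_mult ln_div field_simps)
    have "nat \<lfloor>?N / 2\<rfloor> = N div 2" using floor_divide_of_nat_eq[where ?'a = real, of N 2] by simp
    hence "\<bar>divisor_main (?N / 2) - divisor_main (real (N div 2))\<bar> \<le> \<bar>ln (?N / 2)\<bar> + 1 + ?c"
      using divisor_main_floor[of "?N / 2"] N by simp
    also have "\<bar>ln (?N / 2)\<bar> \<le> ln ?N + ln 2"
      using N by (simp add: ln_div abs_le_iff)
    also have "ln ?N + ln 2 + 1 + ?c \<le> ?N powr s / s + (ln 2 + 1 + ?c) * ?N powr s"
    proof -
      have "(ln 2 + 1 + ?c) * 1 \<le> (ln 2 + 1 + ?c) * ?N powr s"
        using one_le[of ?N] N by (intro mult_left_mono) auto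
      thus ?thesis using ln_le[of ?N] N by simp
    qed
    finally have floor_bound: "2 * \<bar>divisor_main (?N / 2) - divisor_main (real (N div 2))\<bar>
        \<le> B * ?N powr s"
      by (simp add: B_def algebra_simps)
    have "U (2 * N) - 2 * U N = (2 * ?D (2 * N) - 5 * ?D N + 2 * ?D (N div 2) - 3 * ln 2 * ?N)
        + 2 * (divisor_main (?N / 2) - divisor_main (real (N div 2)))"
      unfolding main[symmetric] by (simp add: U_def E_def algebra_simps)
    moreover have "C2 * ?N powr s = (C0 + C1) * 4 powr s * ?N powr s + B * ?N powr s"
      by (simp add: C2_def distrib_right)
    moreover have "\<bar>p + 2 * q\<bar> \<le> P + Q" if "\<bar>p\<bar> \<le> P" "2 * \<bar>q\<bar> \<le> Q" for p q P Q :: real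
      using that by linarith
    note this[OF D_bound floor_bound]
    ultimately show ?thesis by (simp only:)
  qed
  have U_sqrt: "\<bar>U N\<bar> \<le> 24 * sqrt (real N)" for N
  proof -
    have "sqrt (real (N div 2)) \<le> sqrt (real N)" by simp
    thus ?thesis unfolding U_def using sqrt_bound[of N] sqrt_bound[of "N div 2"] by linarith
  qed
  define K where "K = C2 / (2 - 2 powr s)"
  have U_bound: "\<bar>U N\<bar> \<le> K * real N powr s" if "N > 0" for N
    unfolding K_def by (rule doubling_recursion_bound[OF assms(2) U_sqrt U_rec that])
  define L where "L = (K / 2) / (1 - 2 powr (- s))"
  have E_bound: "\<bar>E N\<bar> \<le> L * real N powr s" for N
    unfolding L_def
  proof (rule halving_recursion_bound[where \<mu> = "1 / 2"])
    fix N :: nat assume "N > 0"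
    hence "\<bar>U N / 2\<bar> \<le> K / 2 * real N powr s" using U_bound[of N] by simp
    moreover have "E N - 1 / 2 * E (N div 2) = U N / 2" by (simp add: U_def)
    ultimately show "\<bar>E N - 1 / 2 * E (N div 2)\<bar> \<le> K / 2 * real N powr s"
      by (simp only:)
  qed (use assms(1) E0 in auto)
  have L: "L \<ge> 0" using E_bound[of 1] by simp
  show ?thesis
  proof (rule that[of "L + 1 / s + 1 + ?c"])
    fix x :: real assume x: "x \<ge> 1"
    define N where "N = nat \<lfloor>x\<rfloor>"
    have N: "real N \<le> x" unfolding N_def using x by linarith
    have "Delta_H x = E N - (divisor_main x - divisor_main (real N))"
      using x by (simp add: Delta_H_def N_H_eq_quotient_sum E_def N_def divisor_main_def)
    moreover have "\<bar>E N\<bar> \<le> L * x powr s"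
    proof -
      have "L * real N powr s \<le> L * x powr s"
        using N L assms(1) by (intro mult_left_mono powr_mono2) auto
      thus ?thesis using E_bound[of N] by linarith
    qed
    moreover have "\<bar>divisor_main x - divisor_main (real N)\<bar> \<le> (1 / s + 1 + ?c) * x powr s"
    proof -
      have "\<bar>divisor_main x - divisor_main (real N)\<bar> \<le> ln x + (1 + ?c) * 1"
        using divisor_main_floor[of x] x unfolding N_def by simp
      also have "\<dots> \<le> x powr s / s + (1 + ?c) * x powr s"
        using ln_le[OF x] one_le[OF x] by (intro add_mono mult_left_mono) auto
      finally show ?thesis by (simp add: algebra_simps)
    qed
    ultimately show "\<bar>Delta_H x\<bar> \<le> (L + 1 / s + 1 + ?c) * x powr s" by (simp add: algebra_simps)
  qed
qed

theorem proposition6p1: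
  fixes \<theta> :: real
  assumes "0 \<le> \<theta>" and "\<theta> < 1"
  shows
    "((\<forall>\<epsilon>::real. \<epsilon> > 0 \<longrightarrow> (\<exists>C::real. \<forall>n::nat. n \<ge> 1 \<and> odd n \<longrightarrow>
          \<bar>fib_frac_sum n - pi / 8 * real n\<bar> \<le> C * real n powr (\<theta> + \<epsilon>)))
      \<longrightarrow> (\<forall>\<epsilon>::real. \<epsilon> > 0 \<longrightarrow> (\<exists>C::real. \<forall>x::real. x \<ge> 1 \<longrightarrow>
          \<bar>Delta_C x\<bar> \<le> C * x powr (\<theta> + \<epsilon>))))
   \<and> ((\<forall>\<epsilon>::real. \<epsilon> > 0 \<longrightarrow> (\<exists>C::real. \<forall>n::nat. n \<ge> 1 \<and> even n \<longrightarrow>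
          \<bar>fib_frac_sum n - 3 * ln 2 / 4 * real n\<bar> \<le> C * real n powr (\<theta> + \<epsilon>)))
      \<longrightarrow> (\<forall>\<epsilon>::real. \<epsilon> > 0 \<longrightarrow> (\<exists>C::real. \<forall>x::real. x \<ge> 1 \<longrightarrow>
          \<bar>Delta_H x\<bar> \<le> C * x powr (\<theta> + \<epsilon>))))"
proof (intro conjI impI allI)
  fix \<epsilon> :: real
  assume hyp: "\<forall>\<epsilon>::real. \<epsilon> > 0 \<longrightarrow> (\<exists>C::real. \<forall>n::nat. n \<ge> 1 \<and> odd n \<longrightarrow>
      \<bar>fib_frac_sum n - pi / 8 * real n\<bar> \<le> C * real n powr (\<theta> + \<epsilon>))" and \<epsilon>: "\<epsilon> > 0"
  obtain C0 where C0: "\<And>n. n \<ge> 1 \<Longrightarrow> odd n \<Longrightarrow>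
      \<bar>fib_frac_sum n - pi / 8 * real n\<bar> \<le> C0 * real n powr (\<theta> + \<epsilon>)"
    using hyp \<epsilon> by blast
  have "\<theta> + \<epsilon> > 0" using assms \<epsilon> by simp
  from circle_error_bound[OF this C0]
  show "\<exists>C::real. \<forall>x::real. x \<ge> 1 \<longrightarrow> \<bar>Delta_C x\<bar> \<le> C * x powr (\<theta> + \<epsilon>)" by metis
next
  fix \<epsilon> :: real
  assume hyp: "\<forall>\<epsilon>::real. \<epsilon> > 0 \<longrightarrow> (\<exists>C::real. \<forall>n::nat. n \<ge> 1 \<and> even n \<longrightarrow>
      \<bar>fib_frac_sum n - 3 * ln 2 / 4 * real n\<bar> \<le> C * real n powr (\<theta> + \<epsilon>))" and \<epsilon>: "\<epsilon> > 0"
  \<comment> \<open>The upward iteration requires an exponent below \<open>1\<close>; shrinking \<open>\<epsilon>\<close> only strengthens the conclusion.\<close>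
  define \<delta> where "\<delta> = min \<epsilon> ((1 - \<theta>) / 2)"
  have \<delta>: "\<delta> > 0" "\<delta> \<le> \<epsilon>" "0 < \<theta> + \<delta>" "\<theta> + \<delta> < 1"
    using assms \<epsilon> by (auto simp: \<delta>_def min_def field_simps)
  obtain C0 where C0: "\<And>n. n \<ge> 1 \<Longrightarrow> even n \<Longrightarrow>
      \<bar>fib_frac_sum n - 3 * ln 2 / 4 * real n\<bar> \<le> C0 * real n powr (\<theta> + \<delta>)"
    using hyp \<delta>(1) by blast
  obtain C where C: "\<And>x. x \<ge> 1 \<Longrightarrow> \<bar>Delta_H x\<bar> \<le> C * x powr (\<theta> + \<delta>)"
    using hyperbola_error_bound[OF \<delta>(3,4) C0] by metis
  have C_nonneg: "C \<ge> 0" using C[of 1] by simp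
  have "\<bar>Delta_H x\<bar> \<le> C * x powr (\<theta> + \<epsilon>)" if "x \<ge> 1" for x
  proof -
    have "C * x powr (\<theta> + \<delta>) \<le> C * x powr (\<theta> + \<epsilon>)"
      using that C_nonneg \<delta>(2) by (intro mult_left_mono powr_mono) auto
    thus ?thesis using C[OF that] by linarith
  qed
  thus "\<exists>C::real. \<forall>x::real. x \<ge> 1 \<longrightarrow> \<bar>Delta_H x\<bar> \<le> C * x powr (\<theta> + \<epsilon>)" by blast
qed

end
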